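(* Let $L/K$ be a G-extension (equivalently, a finite Galois field extension), let $G=G(L/K)$ and $E=\mathrm{End}_K(L)$. Then: (1) $\mathcal{A}(E,L)=\{\, C_E(M)=L\rtimes G(L/M)=L\rtimes G^M \mid M\in\mathcal{F}(L/K)\,\}$; that is, for each $M\in\mathcal F(L/K)$ one has $C_E(M)=L\rtimes G(L/M)=L\rtimes G^M$, and $\mathcal A(E,L)$ is exactly the set of these algebras. (2) The map $\mathcal{F}(L/K)\to\mathcal{A}(E,L)$, $M\mapsto C_E(M)=L\rtimes G(L/M)=L\rtimes G^M$, is a bijection with inverse $A\mapsto C_E(A)=L^{A\cap G}$. (3) (The Galois Correspondence) The map $\mathcal{F}(L/K)\to\mathcal{G}(G)$, $M\mapsto G(L/M)=G^M$, is a bijection with inverse $H\mapsto L^H$.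
   Context: For a finite field extension $L/K$: $G=G(L/K)$ is the group of $K$-algebra automorphisms of $L$; $E=E(L/K)=\mathrm{End}_K(L)$ is the algebra of $K$-linear endomorphisms of $L$. The group $G$ is a subset of $E$, and $L$ is regarded as a $K$-subalgebra of $E$ by letting $l\in L$ act on $L$ by multiplication. $\mathcal{F}(L/K)$ is the set of all intermediate fields $K\subseteq M\subseteq L$; $\mathcal{G}(G)$ is the set of all subgroups of $G$; $\mathcal{A}(E,L)$ is the set of all $K$-subalgebras of $E$ that contain $L$. For a subset $S\subseteq E$, $C_E(S)=\{a\in E\mid as=sa\text{ for all }s\in S\}$ is its centralizer. For a subgroup $H\le G$, $L\rtimes H$ denotes the $K$-subalgebra of $E$ generated by $L$ and $H$, i.e. $L\rtimes H=\sum_{h\in H}Lh$ (this sum is direct, and the multiplication is $\lambda g\cdot\mu h=\lambda g(\mu)gh$ for $\lambda,\mu\in L$, $g,h\in H$). The extension $L/K$ is called a G-extension if it is finite and $E=L\rtimes G$. For $M\in\mathcal F(L/K)$, $G(L/M)$ is the group of $M$-algebra automorphisms of $L$ and $G^M=\{g\in G\mid g(m)=m\text{ for all }m\in M\}$. For a subgroup $H\le G$, $L^H=\{l\in L\mid h(l)=l\text{ for all }h\in H\}$. For $A\in\mathcal A(E,L)$, $L^{A\cap G}=\{l\in L\mid g(l)=l\text{ for all }g\in A\cap G\}$, where $A\cap G$ is taken inside $E$. *)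

theory Defs
  imports "HOL-Algebra.Algebra"
begin

text \<open>
  A field extension is a field \<open>L\<close> (a \<open>HOL-Algebra\<close> record) together with a
  subfield \<open>K\<close>, given as a subset of \<open>carrier L\<close>.  Intermediate fields are likewise
  subsets of \<open>carrier L\<close>.
\<close>

definition intermediate_fields :: "('a, 'b) ring_scheme \<Rightarrow> 'a set \<Rightarrow> 'a set set" where
  "intermediate_fields L K = {M. subfield M L \<and> K \<subseteq> M}"

text \<open>
  Endomorphisms are functions on \<open>carrier L\<close> that are \<open>undefined\<close> elsewhere, so that
  equality in the ring of endomorphisms is equality of maps on \<open>carrier L\<close>.
\<close>

definition endo_ring :: "('a, 'b) ring_scheme \<Rightarrow> 'a set \<Rightarrow> ('a \<Rightarrow> 'a) ring" where
  "endo_ring L K =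
    \<lparr>carrier = {f \<in> carrier L \<rightarrow>\<^sub>E carrier L.
        (\<forall>x\<in>carrier L. \<forall>y\<in>carrier L. f (x \<oplus>\<^bsub>L\<^esub> y) = f x \<oplus>\<^bsub>L\<^esub> f y) \<and>
        (\<forall>k\<in>K. \<forall>x\<in>carrier L. f (k \<otimes>\<^bsub>L\<^esub> x) = k \<otimes>\<^bsub>L\<^esub> f x)},
     monoid.mult = compose (carrier L),
     one = (\<lambda>x\<in>carrier L. x),
     ring.zero = (\<lambda>x\<in>carrier L. \<zero>\<^bsub>L\<^esub>),
     ring.add = (\<lambda>f g. \<lambda>x\<in>carrier L. f x \<oplus>\<^bsub>L\<^esub> g x)\<rparr>"

text \<open>The inclusion of \<open>L\<close> in its endomorphism ring is made explicit as \<open>mult_op L\<close>.\<close>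

definition mult_op :: "('a, 'b) ring_scheme \<Rightarrow> 'a \<Rightarrow> 'a \<Rightarrow> 'a" where
  "mult_op L l = (\<lambda>x\<in>carrier L. l \<otimes>\<^bsub>L\<^esub> x)"

definition centralizer :: "('a, 'b) ring_scheme \<Rightarrow> 'a set \<Rightarrow> 'a set" where
  "centralizer R S = {a \<in> carrier R. \<forall>s\<in>S. a \<otimes>\<^bsub>R\<^esub> s = s \<otimes>\<^bsub>R\<^esub> a}"

definition alg_automorphisms :: "('a, 'b) ring_scheme \<Rightarrow> 'a set \<Rightarrow> ('a \<Rightarrow> 'a) set" where
  "alg_automorphisms L K = ring_iso L L \<inter> carrier (endo_ring L K)"

definition galois_group :: "('a, 'b) ring_scheme \<Rightarrow> 'a set \<Rightarrow> ('a \<Rightarrow> 'a) monoid" where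
  "galois_group L K = BijGroup (carrier L) \<lparr>carrier := alg_automorphisms L K\<rparr>"

definition galois_subgroups :: "('a, 'b) ring_scheme \<Rightarrow> 'a set \<Rightarrow> ('a \<Rightarrow> 'a) set set" where
  "galois_subgroups L K = {H. subgroup H (galois_group L K)}"

text \<open>
  The library's \<^const>\<open>subalgebra\<close> only asks for a subspace, closed under multiplication by
  the scalars; closure under the ring multiplication and the unit come from \<^const>\<open>subring\<close>.
  Multiplying an endomorphism by \<open>mult_op L k\<close> is scalar multiplication by \<open>k\<close>.
\<close>

definition endo_subalgebra :: "('a, 'b) ring_scheme \<Rightarrow> 'a set \<Rightarrow> ('a \<Rightarrow> 'a) set \<Rightarrow> bool" where
  "endo_subalgebra L K A \<longleftrightarrow>
     subring A (endo_ring L K) \<and> subalgebra (mult_op L ` K) A (endo_ring L K)"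

definition subalgebras_over :: "('a, 'b) ring_scheme \<Rightarrow> 'a set \<Rightarrow> ('a \<Rightarrow> 'a) set set" where
  "subalgebras_over L K = {A. endo_subalgebra L K A \<and> mult_op L ` carrier L \<subseteq> A}"

text \<open>
  For a subgroup \<open>H\<close> of the Galois group this is the skew group algebra of \<open>H\<close> over \<open>L\<close>, realised
  inside the endomorphism ring; as a set it is the sum of the \<open>L h\<close> for \<open>h \<in> H\<close>.
\<close>

definition skew_algebra ::
    "('a, 'b) ring_scheme \<Rightarrow> 'a set \<Rightarrow> ('a \<Rightarrow> 'a) set \<Rightarrow> ('a \<Rightarrow> 'a) set" where
  "skew_algebra L K H = endo_subalgebra L K hull (mult_op L ` carrier L \<union> H)"

definition G_extension :: "('a, 'b) ring_scheme \<Rightarrow> 'a set \<Rightarrow> bool" where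
  "G_extension L K \<longleftrightarrow>
     field L \<and> subfield K L \<and> ring.finite_dimension L K (carrier L) \<and>
     carrier (endo_ring L K) = skew_algebra L K (carrier (galois_group L K))"

text \<open>In the usual notation, \<open>pointwise_stabilizer L K M\<close> is \<open>G\<^sup>M\<close> and \<open>fixed_field L H\<close> is \<open>L\<^sup>H\<close>.\<close>

definition pointwise_stabilizer ::
    "('a, 'b) ring_scheme \<Rightarrow> 'a set \<Rightarrow> 'a set \<Rightarrow> ('a \<Rightarrow> 'a) set" where
  "pointwise_stabilizer L K M = {g \<in> carrier (galois_group L K). \<forall>m\<in>M. g m = m}"

definition fixed_field :: "('a, 'b) ring_scheme \<Rightarrow> ('a \<Rightarrow> 'a) set \<Rightarrow> 'a set" where
  "fixed_field L H = {l \<in> carrier L. \<forall>h\<in>H. h l = l}"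

end

theory Submission
  imports Defs
begin

text \<open>
  Let \<open>G\<close> be the automorphism group of \<open>L\<close> over \<open>K\<close> and \<open>E\<close> the ring of \<open>K\<close>-linear endomorphisms
  of \<open>L\<close>. The whole correspondence comes from one fact about \<open>L\<close>-\<open>L\<close>-bimodules inside \<open>E\<close>
  (\<open>bimodule_contains_summands\<close>): if such a bimodule contains a finite sum of terms \<open>c\<^sub>h h\<close> with
  distinct automorphisms \<open>h\<close>, it contains every \<open>h\<close> whose coefficient is nonzero. For if \<open>h \<noteq> g\<close>
  differ at \<open>y\<close>, then \<open>a y - g(y) a\<close> lies in the bimodule together with \<open>a\<close>; passing from \<open>a\<close> to it
  multiplies the coefficient at each \<open>f\<close> by \<open>f(y) - g(y)\<close>, which removes the term at \<open>g\<close> and keeps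
  the one at \<open>h\<close>. Applied to the zero bimodule this is Dedekind's linear independence of
  automorphisms, and comparing with the dimension of \<open>L\<close> over \<open>K\<close> shows that \<open>G\<close> is finite.

  In a G-extension each element of \<open>E\<close> is a sum of terms \<open>c\<^sub>h h\<close>. A subalgebra \<open>A\<close> containing \<open>L\<close> is a
  bimodule, so the fact above says that \<open>A\<close> is generated by \<open>L\<close> and \<open>A \<inter> G\<close>
  (\<open>subalgebra_eq_skew_algebra\<close>). For an intermediate field \<open>M\<close>, the centralizer of \<open>M\<close> is the ring of
  \<open>M\<close>-linear maps; it meets \<open>G\<close> in the automorphisms over \<open>M\<close>, hence it is their skew group algebra.
  For a subalgebra \<open>A\<close>, an element of the centralizer commutes with \<open>L\<close>, so it is multiplication by
  its value at \<open>1\<close>, and commuting with \<open>A \<inter> G\<close> means that this value is fixed.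

  It remains to see that the maps are mutually inverse.

  \<^item> An element \<open>l\<close> fixed by the automorphisms over \<open>M\<close> commutes with all \<open>M\<close>-linear maps. If \<open>l\<close> were
    not in \<open>M\<close>, there would be an \<open>M\<close>-linear map that vanishes on \<open>M\<close> but not at \<open>l\<close>
    (\<open>separating_functional\<close>), which does not commute with \<open>l\<close>.

  \<^item> If \<open>H\<close> is a finite set of automorphisms closed under composition and containing the identity,
    then \<open>H\<close> contains each automorphism \<open>g\<close> that fixes \<open>L\<^sup>H\<close> (\<open>stabilizer_of_fixed_field\<close>): the trace
    \<open>T = \<Sum>\<^sub>H h\<close> has values in \<open>L\<^sup>H\<close>, so \<open>g T = T\<close>, and independence of automorphisms gives \<open>g H = H\<close>.
    The set \<open>A \<inter> G\<close> is visibly such a monoid, so this applies to subalgebras as well as to subgroups.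
\<close>

section \<open>The ring of endomorphisms and the group of automorphisms\<close>

lemma endo_ring_simps [simp]:
  "f \<otimes>\<^bsub>endo_ring L K\<^esub> g = compose (carrier L) f g"
  "\<one>\<^bsub>endo_ring L K\<^esub> = (\<lambda>x\<in>carrier L. x)"
  "\<zero>\<^bsub>endo_ring L K\<^esub> = (\<lambda>x\<in>carrier L. \<zero>\<^bsub>L\<^esub>)"
  "f \<oplus>\<^bsub>endo_ring L K\<^esub> g = (\<lambda>x\<in>carrier L. f x \<oplus>\<^bsub>L\<^esub> g x)"
  by (simp_all add: endo_ring_def)

lemma endo_carrierI:
  assumes "f \<in> extensional (carrier L)"
    and "\<And>x. x \<in> carrier L \<Longrightarrow> f x \<in> carrier L"
    and "\<And>x y. x \<in> carrier L \<Longrightarrow> y \<in> carrier L \<Longrightarrow> f (x \<oplus>\<^bsub>L\<^esub> y) = f x \<oplus>\<^bsub>L\<^esub> f y"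
    and "\<And>k x. k \<in> K \<Longrightarrow> x \<in> carrier L \<Longrightarrow> f (k \<otimes>\<^bsub>L\<^esub> x) = k \<otimes>\<^bsub>L\<^esub> f x"
  shows "f \<in> carrier (endo_ring L K)"
  using assms by (auto simp: endo_ring_def PiE_def)

lemma endo_carrierD:
  assumes "f \<in> carrier (endo_ring L K)"
  shows "f \<in> extensional (carrier L)"
    and "x \<in> carrier L \<Longrightarrow> f x \<in> carrier L"
    and "x \<in> carrier L \<Longrightarrow> y \<in> carrier L \<Longrightarrow> f (x \<oplus>\<^bsub>L\<^esub> y) = f x \<oplus>\<^bsub>L\<^esub> f y"
    and "k \<in> K \<Longrightarrow> x \<in> carrier L \<Longrightarrow> f (k \<otimes>\<^bsub>L\<^esub> x) = k \<otimes>\<^bsub>L\<^esub> f x"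
  using assms by (auto simp: endo_ring_def PiE_def)

lemma alg_automorphismsD:
  assumes "h \<in> alg_automorphisms L K"
  shows "h \<in> carrier (endo_ring L K)" "h \<in> ring_iso L L" "h \<in> ring_hom L L"
    "h \<in> extensional (carrier L)" "bij_betw h (carrier L) (carrier L)"
  using assms endo_carrierD(1)[of h L K] by (auto simp: alg_automorphisms_def ring_iso_def)

lemma carrier_galois_group [simp]: "carrier (galois_group L K) = alg_automorphisms L K"
  by (simp add: galois_group_def)

definition skew_sum ::
    "('a, 'b) ring_scheme \<Rightarrow> ('a \<Rightarrow> 'a) set \<Rightarrow> (('a \<Rightarrow> 'a) \<Rightarrow> 'a) \<Rightarrow> 'a \<Rightarrow> 'a" where
  "skew_sum L F c = (\<lambda>x\<in>carrier L. \<Oplus>\<^bsub>L\<^esub>h\<in>F. c h \<otimes>\<^bsub>L\<^esub> h x)"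

context field
begin

lemma endo_ring_is_ring:
  assumes K: "K \<subseteq> carrier R"
  shows "ring (endo_ring R K)"
proof -
  let ?E = "endo_ring R K"
  note [simp] = subsetD[OF K] endo_carrierD(2) endo_carrierD(3) endo_carrierD(4)
  have add_cl: "f \<oplus>\<^bsub>?E\<^esub> g \<in> carrier ?E" if "f \<in> carrier ?E" "g \<in> carrier ?E" for f g
    using that
    by (intro endo_carrierI) (auto simp: a_ac r_distr)
  have zero_cl: "\<zero>\<^bsub>?E\<^esub> \<in> carrier ?E"
    by (intro endo_carrierI) auto
  have one_cl: "\<one>\<^bsub>?E\<^esub> \<in> carrier ?E"
    by (intro endo_carrierI) auto
  have mult_cl: "f \<otimes>\<^bsub>?E\<^esub> g \<in> carrier ?E" if "f \<in> carrier ?E" "g \<in> carrier ?E" for f g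
    using that by (intro endo_carrierI) (auto simp: compose_def)
  have ext: "f = g" if "f \<in> extensional (carrier R)" "g \<in> extensional (carrier R)"
    "\<And>x. x \<in> carrier R \<Longrightarrow> f x = g x" for f g :: "'a \<Rightarrow> 'a"
    using that by (rule extensionalityI)
  have neg: "\<exists>g\<in>carrier ?E. g \<oplus>\<^bsub>?E\<^esub> f = \<zero>\<^bsub>?E\<^esub>" if f: "f \<in> carrier ?E" for f
  proof
    show "(\<lambda>x\<in>carrier R. \<ominus> f x) \<in> carrier ?E"
      using f by (intro endo_carrierI) (auto simp: minus_add r_minus)
    show "(\<lambda>x\<in>carrier R. \<ominus> f x) \<oplus>\<^bsub>?E\<^esub> f = \<zero>\<^bsub>?E\<^esub>"
      using f by (intro ext) (auto simp: l_neg)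
  qed
  have "abelian_group ?E"
    by (rule abelian_groupI[OF add_cl zero_cl])
      (use neg in \<open>auto intro!: ext simp: a_ac endo_carrierD(1)\<close>)
  moreover have "monoid ?E"
    by (rule monoidI[OF mult_cl one_cl])
      (auto intro!: ext simp: compose_def endo_carrierD(1))
  ultimately show ?thesis
    by (rule ringI) (auto intro!: ext simp: compose_def)
qed

lemma endo_ring_uminus:
  assumes K: "K \<subseteq> carrier R" and f: "f \<in> carrier (endo_ring R K)"
  shows "\<ominus>\<^bsub>endo_ring R K\<^esub> f = (\<lambda>x\<in>carrier R. \<ominus> f x)"
proof -
  interpret E: ring "endo_ring R K" using endo_ring_is_ring[OF K] .
  note fx = endo_carrierD[OF f]
  show ?thesis
  proof (rule E.minus_equality)
    show "(\<lambda>x\<in>carrier R. \<ominus> f x) \<in> carrier (endo_ring R K)"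
      using fx subsetD[OF K] by (intro endo_carrierI) (auto simp: minus_add r_minus)
    show "(\<lambda>x\<in>carrier R. \<ominus> f x) \<oplus>\<^bsub>endo_ring R K\<^esub> f = \<zero>\<^bsub>endo_ring R K\<^esub>"
      using fx by (auto intro!: restrict_ext simp: l_neg)
  qed (rule f)
qed

lemma mult_op_closed:
  assumes "K \<subseteq> carrier R" "l \<in> carrier R"
  shows "mult_op R l \<in> carrier (endo_ring R K)"
  using assms by (intro endo_carrierI) (auto simp: mult_op_def r_distr m_lcomm subset_iff)

lemma alg_automorphisms_subgroup:
  assumes K: "K \<subseteq> carrier R"
  shows "subgroup (alg_automorphisms R K) (BijGroup (carrier R))"
proof (rule group.subgroupI[OF group_BijGroup])
  let ?G = "alg_automorphisms R K"
  have bij: "h \<in> Bij (carrier R)" if "h \<in> ?G" for h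
    using alg_automorphismsD[OF that] by (simp add: Bij_def)
  then show "?G \<subseteq> carrier (BijGroup (carrier R))"
    by (auto simp: BijGroup_def)
  interpret E: ring "endo_ring R K" using endo_ring_is_ring[OF K] .
  have "(\<lambda>x\<in>carrier R. x) \<in> ring_iso R R"
    by (rule ring_iso_restrict[OF ring_iso_set_refl]) simp
  then have "(\<lambda>x\<in>carrier R. x) \<in> ?G"
    using E.one_closed by (simp add: alg_automorphisms_def)
  then show "?G \<noteq> {}" by blast
  show "inv\<^bsub>BijGroup (carrier R)\<^esub> h \<in> ?G" if h: "h \<in> ?G" for h
  proof -
    let ?i = "\<lambda>x\<in>carrier R. inv_into (carrier R) h x"
    note hh = alg_automorphismsD[OF h]
    have iso: "?i \<in> ring_iso R R"
      by (rule ring_iso_restrict[OF ring_iso_set_sym[OF ring_axioms hh(2)]]) simp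
    then have cl: "?i x \<in> carrier R" if "x \<in> carrier R" for x
      using that ring_iso_memE(1)[OF iso that] by simp
    have hi: "h (?i x) = x" if "x \<in> carrier R" for x
      using that hh(5) by (simp add: bij_betw_inv_into_right)
    have "?i \<in> carrier (endo_ring R K)"
    proof (rule endo_carrierI)
      show "?i (x \<oplus> y) = ?i x \<oplus> ?i y" if "x \<in> carrier R" "y \<in> carrier R" for x y
        using ring_iso_memE(3)[OF iso that] .
      show "?i (k \<otimes> x) = k \<otimes> ?i x" if k: "k \<in> K" and x: "x \<in> carrier R" for k x
      proof (rule inj_onD[OF bij_betw_imp_inj_on[OF hh(5)]])
        show "h (?i (k \<otimes> x)) = h (k \<otimes> ?i x)"
          using hi[of "k \<otimes> x"] hi[OF x] endo_carrierD(4)[OF hh(1) k cl[OF x]] k x K by auto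
      qed (use k x K cl in auto)
    qed (use cl in auto)
    with iso have "?i \<in> ?G" by (simp add: alg_automorphisms_def)
    then show ?thesis by (simp add: inv_BijGroup[OF bij[OF h]])
  qed
  show "g \<otimes>\<^bsub>BijGroup (carrier R)\<^esub> h \<in> ?G" if gh: "g \<in> ?G" "h \<in> ?G" for g h
  proof -
    have "compose (carrier R) g h \<in> ring_iso R R"
      by (rule ring_iso_restrict[OF ring_iso_set_trans[of h R R g R]])
        (use gh alg_automorphismsD(2) in \<open>auto simp: compose_def\<close>)
    moreover have "compose (carrier R) g h \<in> carrier (endo_ring R K)"
      using E.m_closed[of g h] gh alg_automorphismsD(1) by auto
    ultimately show ?thesis
      using gh bij by (simp add: BijGroup_def alg_automorphisms_def)
  qed
qed

lemma skew_sum_closed: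
  assumes K: "K \<subseteq> carrier R" and F: "F \<subseteq> carrier (endo_ring R K)" and c: "c \<in> F \<rightarrow> carrier R"
  shows "skew_sum R F c \<in> carrier (endo_ring R K)"
proof (rule endo_carrierI)
  note [simp] = endo_carrierD(2)[OF subsetD[OF F]] funcset_mem[OF c]
  show "skew_sum R F c (x \<oplus> y) = skew_sum R F c x \<oplus> skew_sum R F c y"
    if xy: "x \<in> carrier R" "y \<in> carrier R" for x y
  proof -
    have "(\<Oplus>h\<in>F. c h \<otimes> h (x \<oplus> y)) = (\<Oplus>h\<in>F. c h \<otimes> h x \<oplus> c h \<otimes> h y)"
      by (rule finsum_cong') (use xy in \<open>auto simp: endo_carrierD(3)[OF subsetD[OF F]] r_distr\<close>)
    then show ?thesis using xy by (simp add: skew_sum_def finsum_addf)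
  qed
  show "skew_sum R F c (k \<otimes> x) = k \<otimes> skew_sum R F c x" if k: "k \<in> K" and x: "x \<in> carrier R" for k x
  proof -
    have k': "k \<in> carrier R" using k K by auto
    have "(\<Oplus>h\<in>F. c h \<otimes> h (k \<otimes> x)) = (\<Oplus>h\<in>F. k \<otimes> (c h \<otimes> h x))"
      by (rule finsum_cong')
        (use k k' x in \<open>auto simp: endo_carrierD(4)[OF subsetD[OF F]] m_lcomm\<close>)
    also have "\<dots> = k \<otimes> (\<Oplus>h\<in>F. c h \<otimes> h x)"
    proof (cases "finite F")
      case True
      then show ?thesis using k' x by (simp add: finsum_rdistr)
    next
      case False
      then show ?thesis using k' by (simp add: finsum_infinite)
    qed
    finally show ?thesis using k' x by (simp add: skew_sum_def)
  qed
qed (auto simp: skew_sum_def intro!: finsum_closed dest: endo_carrierD(2)[OF subsetD[OF F]] funcset_mem[OF c])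

end

section \<open>Bimodules and the independence of automorphisms\<close>

context field
begin

lemma finsum_remove_zero_term:
  assumes "finite F" "h \<in> F" "f \<in> F \<rightarrow> carrier R" "f h = \<zero>"
  shows "finsum R f F = finsum R f (F - {h})"
proof -
  have "finsum R f (insert h (F - {h})) = f h \<oplus> finsum R f (F - {h})"
    using assms by (intro finsum_insert) auto
  moreover have "finsum R f (F - {h}) \<in> carrier R"
    using assms(3) by (intro finsum_closed) auto
  ultimately show ?thesis using assms by (simp add: insert_absorb)
qed

text \<open>
  Induction on the number of terms. When a second term, at \<open>g\<close>, is present, the difference of the
  right multiple by \<open>y\<close> and the left multiple by \<open>g(y)\<close> is a shorter sum in \<open>A\<close>, and its coefficient
  at \<open>h\<close> is still nonzero provided that \<open>h\<close> and \<open>g\<close> differ at \<open>y\<close>. A single term \<open>c\<^sub>h h\<close> gives \<open>h\<close> upon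
  division by \<open>c\<^sub>h\<close>.
\<close>

lemma bimodule_contains_summands:
  assumes diff: "\<And>f g. f \<in> A \<Longrightarrow> g \<in> A \<Longrightarrow> (\<lambda>x\<in>carrier R. f x \<ominus> g x) \<in> A"
    and left: "\<And>l f. l \<in> carrier R \<Longrightarrow> f \<in> A \<Longrightarrow> (\<lambda>x\<in>carrier R. l \<otimes> f x) \<in> A"
    and right: "\<And>l f. l \<in> carrier R \<Longrightarrow> f \<in> A \<Longrightarrow> (\<lambda>x\<in>carrier R. f (l \<otimes> x)) \<in> A"
    and "finite F" and "F \<subseteq> ring_hom R R \<inter> extensional (carrier R)"
    and "c \<in> F \<rightarrow> carrier R" and "skew_sum R F c \<in> A" and "h \<in> F" and "c h \<noteq> \<zero>"
  shows "h \<in> A"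
  using assms(4-)
proof (induction "card F" arbitrary: F c rule: less_induct)
  case less
  note c [simp] = funcset_mem[OF less.prems(3)]
  have hom: "f \<in> ring_hom R R" "f \<in> extensional (carrier R)" if "f \<in> F" for f
    using less.prems(2) that by auto
  have [simp]: "f x \<in> carrier R" if "f \<in> F" "x \<in> carrier R" for f x
    using ring_hom_closed[OF hom(1)] that by auto
  show ?case
  proof (cases "F = {h}")
    case True
    let ?k = "inv (c h)"
    have inv: "?k \<in> carrier R" "?k \<otimes> c h = \<one>"
      using less.prems(5,6) field_Units by (auto intro!: Units_l_inv Units_inv_closed)
    have "(\<lambda>x\<in>carrier R. ?k \<otimes> skew_sum R F c x) = h"
    proof (rule extensionalityI)
      fix x assume x: "x \<in> carrier R"
      have "skew_sum R F c x = c h \<otimes> h x"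
        using x less.prems(5) True by (simp add: skew_sum_def finsum_insert)
      then show "(\<lambda>x\<in>carrier R. ?k \<otimes> skew_sum R F c x) x = h x"
        using x inv less.prems(5) by (simp add: m_assoc[symmetric])
    qed (use hom less.prems(5) in auto)
    then show ?thesis
      using left[OF inv(1) less.prems(4)] by simp
  next
    case False
    then obtain g where g: "g \<in> F" "g \<noteq> h" using less.prems(5) by blast
    obtain y where y: "y \<in> carrier R" "h y \<noteq> g y"
      using g less.prems(5) hom extensionalityI[of h "carrier R" g] by auto
    \<comment> \<open>The coefficients of \<open>a y - g(y) a\<close>, where \<open>a\<close> is the given sum.\<close>
    define d where "d = (\<lambda>f. c f \<otimes> (f y \<ominus> g y))"
    let ?F = "F - {g}"
    have "skew_sum R ?F d =
      (\<lambda>x\<in>carrier R. (\<lambda>x\<in>carrier R. skew_sum R F c (y \<otimes> x)) x \<ominus>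
                      (\<lambda>x\<in>carrier R. g y \<otimes> skew_sum R F c x) x)"
    proof (rule extensionalityI)
      fix x assume x: "x \<in> carrier R"
      have "skew_sum R ?F d x = (\<Oplus>f\<in>F. d f \<otimes> f x)"
      proof -
        have "d g = \<zero>" using g y by (simp add: d_def minus_eq r_neg)
        then have "(\<Oplus>f\<in>F. d f \<otimes> f x) = (\<Oplus>f\<in>?F. d f \<otimes> f x)"
          using g x y by (intro finsum_remove_zero_term[OF less.prems(1) g(1)]) (auto simp: d_def)
        then show ?thesis using x by (simp add: skew_sum_def)
      qed
      also have "\<dots> = (\<Oplus>f\<in>F. c f \<otimes> f (y \<otimes> x) \<oplus> (\<ominus> g y) \<otimes> (c f \<otimes> f x))"
      proof (rule finsum_cong')
        fix f assume f: "f \<in> F"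
        have "f (y \<otimes> x) = f y \<otimes> f x" using ring_hom_mult[OF hom(1)[OF f]] x y by simp
        moreover have "c f \<in> carrier R" "f y \<in> carrier R" "f x \<in> carrier R" "g y \<in> carrier R"
          using f g x y by auto
        ultimately show "d f \<otimes> f x = c f \<otimes> f (y \<otimes> x) \<oplus> (\<ominus> g y) \<otimes> (c f \<otimes> f x)"
          unfolding d_def by (simp only:) algebra
      qed (use g x y in auto)
      also have "\<dots> = skew_sum R F c (y \<otimes> x) \<oplus> (\<ominus> g y) \<otimes> skew_sum R F c x"
        using x y g less.prems(1) by (simp add: skew_sum_def finsum_addf finsum_rdistr)
      also have "\<dots> = skew_sum R F c (y \<otimes> x) \<ominus> g y \<otimes> skew_sum R F c x"
      proof -
        have "skew_sum R F c x \<in> carrier R" if "x \<in> carrier R" for x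
          using that by (auto simp: skew_sum_def intro!: finsum_closed)
        then show ?thesis using x y g by (simp add: minus_eq l_minus)
      qed
      finally show "skew_sum R ?F d x = (\<lambda>x\<in>carrier R. (\<lambda>x\<in>carrier R. skew_sum R F c (y \<otimes> x)) x \<ominus>
                      (\<lambda>x\<in>carrier R. g y \<otimes> skew_sum R F c x) x) x"
        using x by simp
    qed (auto simp: skew_sum_def)
    then have inA: "skew_sum R ?F d \<in> A"
      using diff[OF right[OF y(1) less.prems(4)] left[OF _ less.prems(4), of "g y"]] g y by simp
    have "d h \<noteq> \<zero>"
      using y g less.prems(5,6) by (auto simp: d_def integral_iff)
    moreover have "d \<in> ?F \<rightarrow> carrier R" using y g by (auto simp: d_def)
    moreover have "card ?F < card F" by (rule card_Diff1_less[OF less.prems(1) g(1)])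
    ultimately show ?thesis
      using less.hyps[of ?F d] less.prems g inA by auto
  qed
qed

text \<open>
  Dedekind's independence theorem, obtained by taking the zero bimodule, which contains no ring
  homomorphism because \<open>1 \<noteq> 0\<close>.
\<close>

corollary ring_homs_linearly_independent:
  assumes "finite F" and "F \<subseteq> ring_hom R R \<inter> extensional (carrier R)"
    and "c \<in> F \<rightarrow> carrier R" and "\<And>x. x \<in> carrier R \<Longrightarrow> (\<Oplus>h\<in>F. c h \<otimes> h x) = \<zero>" and "h \<in> F"
  shows "c h = \<zero>"
proof (rule ccontr)
  assume nz: "c h \<noteq> \<zero>"
  have "skew_sum R F c = (\<lambda>x\<in>carrier R. \<zero>)"
    using assms(4) by (auto simp: skew_sum_def intro!: restrict_ext)
  then have "h \<in> {\<lambda>x\<in>carrier R. \<zero>}"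
    by (intro bimodule_contains_summands[OF _ _ _ assms(1,2,3) _ assms(5) nz])
      (auto intro!: restrict_ext simp: minus_eq)
  then have "h \<one> = \<zero>" by simp
  moreover have "h \<one> = \<one>" using assms(2,5) ring_hom_one[of h R R] by auto
  ultimately show False by simp
qed

end

section \<open>Finiteness of the automorphism group\<close>

context field
begin

text \<open>
  A homogeneous linear system with more unknowns than equations has a nontrivial solution; here the
  unknowns are the coefficients of the maps, and a basis of \<open>V\<close> gives the equations. In the induction step, let
  \<open>V\<close> be enlarged by \<open>v\<close>. The induction hypothesis gives two solutions \<open>a\<close> and \<open>b\<close> for \<open>V\<close> that are not
  proportional, because \<open>b\<close> vanishes at an index where \<open>a\<close> does not, and some nontrivial combination of
  them also vanishes at \<open>v\<close>.
\<close>

lemma maps_dependent_on_finite_dimension: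
  assumes "dimension n K V" and "subfield K R"
    and "finite F" and "n < card F" and "F \<subseteq> carrier (endo_ring R K)"
  shows "\<exists>c\<in>F \<rightarrow> carrier R. (\<exists>h\<in>F. c h \<noteq> \<zero>) \<and> (\<forall>v\<in>V. (\<Oplus>h\<in>F. c h \<otimes> h v) = \<zero>)"
  using assms
proof (induction arbitrary: F rule: dimension.induct)
  case (zero_dim K)
  have h0: "h \<zero> = \<zero>" if "h \<in> F" for h
  proof -
    have h: "h \<in> carrier (endo_ring R K)" using that zero_dim by auto
    have "h \<zero> \<oplus> h \<zero> = h (\<zero> \<oplus> \<zero>)"
      by (rule endo_carrierD(3)[OF h, symmetric]) simp_all
    then have "h \<zero> \<oplus> h \<zero> = h \<zero>" by simp
    with endo_carrierD(2)[OF h, of \<zero>] show ?thesis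
      using add.r_cancel_one by blast
  qed
  have "(\<Oplus>h\<in>F. \<one> \<otimes> h \<zero>) = (\<Oplus>h\<in>F. \<zero>)"
    by (rule finsum_cong') (auto simp: h0)
  moreover have "F \<noteq> {}" using zero_dim by auto
  ultimately show ?case by (intro bexI[of _ "\<lambda>_. \<one>"]) (auto simp: finsum_zero)
next
  case (Suc_dim v V n K)
  note F = subsetD[OF Suc_dim.prems(4)]
  note fin = Suc_dim.prems(2)
  have K: "K \<subseteq> carrier R" using subfieldE(3)[OF Suc_dim.prems(1)] .
  have V: "V \<subseteq> carrier R"
    using exists_base[OF Suc_dim.prems(1) Suc_dim.hyps(3)] Span_in_carrier[OF K] by blast
  have sub: "\<exists>c\<in>F \<rightarrow> carrier R. c g = \<zero> \<and> (\<exists>h\<in>F. c h \<noteq> \<zero>) \<and> (\<forall>v\<in>V. (\<Oplus>h\<in>F. c h \<otimes> h v) = \<zero>)"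
    if g: "g \<in> F" for g
  proof -
    have "n < card (F - {g})" using Suc_dim.prems(3) g fin by simp
    then obtain c h where c: "c \<in> F - {g} \<rightarrow> carrier R" "h \<in> F - {g}" "c h \<noteq> \<zero>"
      "\<forall>v\<in>V. (\<Oplus>h\<in>F - {g}. c h \<otimes> h v) = \<zero>"
      using Suc_dim.IH[of "F - {g}"] Suc_dim.prems by blast
    define d where "d = c(g := \<zero>)"
    have dc: "d \<in> F \<rightarrow> carrier R" using c by (auto simp: d_def)
    have "(\<Oplus>h\<in>F. d h \<otimes> h v) = \<zero>" if "v \<in> V" for v
    proof -
      have v: "v \<in> carrier R" using that V by auto
      note hv = endo_carrierD(2)[OF F v]
      have "(\<Oplus>h\<in>F. d h \<otimes> h v) = (\<Oplus>h\<in>F - {g}. d h \<otimes> h v)"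
      proof (rule finsum_remove_zero_term[OF fin g])
        show "(\<lambda>h. d h \<otimes> h v) \<in> F \<rightarrow> carrier R"
          using dc hv by blast
      qed (simp add: d_def hv g)
      also have "\<dots> = (\<Oplus>h\<in>F - {g}. c h \<otimes> h v)"
      proof (rule finsum_cong')
        show "(\<lambda>h. c h \<otimes> h v) \<in> F - {g} \<rightarrow> carrier R"
          using c(1) hv by blast
      qed (auto simp: d_def)
      finally show ?thesis using c that by simp
    qed
    then show ?thesis using dc c by (intro bexI[of _ d]) (auto simp: d_def)
  qed
  \<comment> \<open>The second solution is required to vanish at an index \<open>h\<close> where the first one does not.\<close>
  obtain g where "g \<in> F" using Suc_dim.prems(3) by fastforce
  from sub[OF this] obtain a h where a: "a \<in> F \<rightarrow> carrier R" "h \<in> F" "a h \<noteq> \<zero>"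
    "\<And>v. v \<in> V \<Longrightarrow> (\<Oplus>h\<in>F. a h \<otimes> h v) = \<zero>" by blast
  from sub[OF \<open>h \<in> F\<close>] obtain b where b: "b \<in> F \<rightarrow> carrier R" "b h = \<zero>" "\<exists>h\<in>F. b h \<noteq> \<zero>"
    "\<And>v. v \<in> V \<Longrightarrow> (\<Oplus>h\<in>F. b h \<otimes> h v) = \<zero>" by blast
  define s where "s c = (\<Oplus>h\<in>F. c h \<otimes> h v)" for c
  have s_cl: "s c \<in> carrier R" if "c \<in> F \<rightarrow> carrier R" for c
    unfolding s_def
    by (rule finsum_closed) (simp add: Pi_iff funcset_mem[OF that] endo_carrierD(2)[OF F Suc_dim.hyps(1)])
  have comb: "(\<Oplus>h\<in>F. (l \<otimes> a h \<ominus> m \<otimes> b h) \<otimes> h w) =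
      l \<otimes> (\<Oplus>h\<in>F. a h \<otimes> h w) \<ominus> m \<otimes> (\<Oplus>h\<in>F. b h \<otimes> h w)"
    if lm: "l \<in> carrier R" "m \<in> carrier R" and w: "w \<in> carrier R" for l m w
  proof -
    note [simp] = funcset_mem[OF a(1)] funcset_mem[OF b(1)] endo_carrierD(2)[OF F w]
    have "(\<Oplus>h\<in>F. (l \<otimes> a h \<ominus> m \<otimes> b h) \<otimes> h w) =
        (\<Oplus>h\<in>F. l \<otimes> (a h \<otimes> h w) \<oplus> (\<ominus> m) \<otimes> (b h \<otimes> h w))"
    proof (rule finsum_cong')
      fix h assume "h \<in> F"
      then have "a h \<in> carrier R" "b h \<in> carrier R" "h w \<in> carrier R" by auto
      then show "(l \<otimes> a h \<ominus> m \<otimes> b h) \<otimes> h w = l \<otimes> (a h \<otimes> h w) \<oplus> (\<ominus> m) \<otimes> (b h \<otimes> h w)"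
        using lm by algebra
    qed (use lm in auto)
    also have "\<dots> = l \<otimes> (\<Oplus>h\<in>F. a h \<otimes> h w) \<oplus> (\<ominus> m) \<otimes> (\<Oplus>h\<in>F. b h \<otimes> h w)"
      using lm fin by (simp add: finsum_addf finsum_rdistr)
    also have "\<dots> = l \<otimes> (\<Oplus>h\<in>F. a h \<otimes> h w) \<ominus> m \<otimes> (\<Oplus>h\<in>F. b h \<otimes> h w)"
      using lm by (simp add: minus_eq l_minus)
    finally show ?thesis .
  qed
  have vanish: "\<forall>u\<in>line_extension K v V. (\<Oplus>h\<in>F. c h \<otimes> h u) = \<zero>"
    if c: "c \<in> F \<rightarrow> carrier R" and cv: "s c = \<zero>" and cV: "\<And>w. w \<in> V \<Longrightarrow> (\<Oplus>h\<in>F. c h \<otimes> h w) = \<zero>" for c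
  proof
    fix u assume "u \<in> line_extension K v V"
    then obtain k w where kw: "k \<in> K" "w \<in> V" "u = k \<otimes> v \<oplus> w"
      using line_extension_mem_iff by blast
    have kwc: "k \<in> carrier R" "w \<in> carrier R" using kw K V by auto
    have T: "skew_sum R F c \<in> carrier (endo_ring R K)"
      by (rule skew_sum_closed[OF K Suc_dim.prems(4) c])
    have "(\<Oplus>h\<in>F. c h \<otimes> h u) = skew_sum R F c u"
      using kw(3) kwc Suc_dim.hyps(1) by (simp add: skew_sum_def)
    also have "\<dots> = k \<otimes> skew_sum R F c v \<oplus> skew_sum R F c w"
      using endo_carrierD(3,4)[OF T] kw kwc Suc_dim.hyps(1) by simp
    also have "\<dots> = \<zero>"
      using cv cV[OF kw(2)] kwc Suc_dim.hyps(1) by (simp add: skew_sum_def s_def)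
    finally show "(\<Oplus>h\<in>F. c h \<otimes> h u) = \<zero>" .
  qed
  show ?case
  proof (cases "s b = \<zero>")
    case True
    then show ?thesis using vanish[OF b(1)] b by blast
  next
    case False
    let ?c = "\<lambda>h. s b \<otimes> a h \<ominus> s a \<otimes> b h"
    have c: "?c \<in> F \<rightarrow> carrier R" using a b s_cl by (auto simp: Pi_iff)
    moreover have "?c h \<noteq> \<zero>"
      using False a(1,2,3) b(1,2) s_cl by (auto simp: minus_eq integral_iff Pi_iff)
    moreover have "\<forall>u\<in>line_extension K v V. (\<Oplus>h\<in>F. ?c h \<otimes> h u) = \<zero>"
    proof (rule vanish[OF c])
      have "s ?c = s b \<otimes> s a \<ominus> s a \<otimes> s b"
        using comb[OF s_cl[OF b(1)] s_cl[OF a(1)] Suc_dim.hyps(1)] by (simp only: s_def)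
      then show "s ?c = \<zero>" using s_cl[OF a(1)] s_cl[OF b(1)] by (simp add: minus_eq r_neg m_comm)
      show "(\<Oplus>h\<in>F. ?c h \<otimes> h w) = \<zero>" if "w \<in> V" for w
        using comb[OF s_cl[OF b(1)] s_cl[OF a(1)] subsetD[OF V that]] a(4)[OF that] b(4)[OF that]
          s_cl[OF b(1)] s_cl[OF a(1)] by (simp add: minus_eq)
    qed
    ultimately show ?thesis using a(2) by (intro bexI[of _ ?c] conjI bexI[of _ h])
  qed
qed

text \<open>
  More automorphisms than the dimension of \<open>L\<close> over \<open>K\<close> would be linearly dependent over \<open>L\<close>, against
  Dedekind's theorem.
\<close>

lemma alg_automorphisms_finite:
  assumes "subfield K R" and "finite_dimension K (carrier R)"
  shows "finite (alg_automorphisms R K)"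
proof (rule ccontr)
  assume inf: "infinite (alg_automorphisms R K)"
  obtain n where n: "dimension n K (carrier R)"
    using assms(2) by (auto simp: finite_dimension_def)
  obtain F where F: "finite F" "card F = Suc n" "F \<subseteq> alg_automorphisms R K"
    using infinite_arbitrarily_large[OF inf] by blast
  have sub: "F \<subseteq> carrier (endo_ring R K)" "F \<subseteq> ring_hom R R \<inter> extensional (carrier R)"
    using F(3) alg_automorphismsD(1,3,4) by blast+
  have "n < card F" using F(2) by simp
  from maps_dependent_on_finite_dimension[OF n assms(1) F(1) this sub(1)]
  obtain c h where c: "c \<in> F \<rightarrow> carrier R" "h \<in> F" "c h \<noteq> \<zero>"
      "\<forall>v\<in>carrier R. (\<Oplus>h\<in>F. c h \<otimes> h v) = \<zero>"
    by blast
  have "c h = \<zero>"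
    by (rule ring_homs_linearly_independent[OF F(1) sub(2) c(1) _ c(2)]) (use c(4) in blast)
  with c(3) show False ..
qed

end

section \<open>Centralizers and subalgebras containing the field\<close>

lemma (in ring) centralizer_is_subring:
  assumes S: "S \<subseteq> carrier R"
  shows "subring (centralizer R S) R"
proof (rule subringI)
  note S' = subsetD[OF S]
  have D: "f \<in> carrier R" "s \<in> S \<Longrightarrow> f \<otimes> s = s \<otimes> f" if "f \<in> centralizer R S" for f s
    using that by (simp_all add: centralizer_def)
  have I: "f \<in> centralizer R S" if "f \<in> carrier R" "\<And>s. s \<in> S \<Longrightarrow> f \<otimes> s = s \<otimes> f" for f
    using that by (simp add: centralizer_def)
  show "centralizer R S \<subseteq> carrier R" using D(1) by blast
  show "\<one> \<in> centralizer R S" by (rule I) (simp_all add: S')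
  show "\<ominus> h \<in> centralizer R S" if h: "h \<in> centralizer R S" for h
    by (rule I) (simp_all add: D(1)[OF h] D(2)[OF h] S' l_minus r_minus)
  show "g \<otimes> h \<in> centralizer R S" if g: "g \<in> centralizer R S" and h: "h \<in> centralizer R S" for g h
  proof (rule I)
    fix s assume s: "s \<in> S"
    note cl = D(1)[OF g] D(1)[OF h] S'[OF s]
    have "g \<otimes> h \<otimes> s = g \<otimes> (s \<otimes> h)"
      using cl by (simp add: m_assoc D(2)[OF h s])
    also have "\<dots> = (s \<otimes> g) \<otimes> h"
      using cl by (simp add: D(2)[OF g s] flip: m_assoc)
    also have "\<dots> = s \<otimes> (g \<otimes> h)"
      using cl by (simp add: m_assoc)
    finally show "g \<otimes> h \<otimes> s = s \<otimes> (g \<otimes> h)" .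
  qed (simp add: D(1)[OF g] D(1)[OF h])
  show "g \<oplus> h \<in> centralizer R S" if g: "g \<in> centralizer R S" and h: "h \<in> centralizer R S" for g h
    by (rule I) (simp_all add: D(1)[OF g] D(1)[OF h] D(2)[OF g] D(2)[OF h] S' l_distr r_distr)
qed

context field
begin

lemma mult_op_compose:
  assumes "f \<in> carrier (endo_ring R K)"
  shows "compose (carrier R) (mult_op R l) f = (\<lambda>x\<in>carrier R. l \<otimes> f x)"
  unfolding compose_def mult_op_def
  by (rule restrict_ext) (simp add: endo_carrierD(2)[OF assms])

lemma compose_mult_op:
  assumes "l \<in> carrier R"
  shows "compose (carrier R) f (mult_op R l) = (\<lambda>x\<in>carrier R. f (l \<otimes> x))"
  unfolding compose_def mult_op_def by (rule restrict_ext) (simp add: assms)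

text \<open>
  Commuting with multiplication by \<open>m\<close> is linearity with respect to the scalar \<open>m\<close>.
\<close>

lemma centralizer_mult_op:
  assumes "K \<subseteq> M" and M: "M \<subseteq> carrier R"
  shows "centralizer (endo_ring R K) (mult_op R ` M) = carrier (endo_ring R M)"
proof (intro Set.set_eqI iffI)
  fix f assume f: "f \<in> centralizer (endo_ring R K) (mult_op R ` M)"
  then have fE: "f \<in> carrier (endo_ring R K)" by (simp add: centralizer_def)
  show "f \<in> carrier (endo_ring R M)"
  proof (rule endo_carrierI)
    fix m x assume m: "m \<in> M" and x: "x \<in> carrier R"
    have "compose (carrier R) f (mult_op R m) = compose (carrier R) (mult_op R m) f"
      using f m by (simp add: centralizer_def)
    then have "(\<lambda>x\<in>carrier R. f (m \<otimes> x)) x = (\<lambda>x\<in>carrier R. m \<otimes> f x) x"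
      using compose_mult_op mult_op_compose[OF fE] m M by (metis subsetD)
    then show "f (m \<otimes> x) = m \<otimes> f x" using x by simp
  qed (use endo_carrierD[OF fE] in auto)
next
  fix f assume f: "f \<in> carrier (endo_ring R M)"
  note fD = endo_carrierD[OF f]
  have fE: "f \<in> carrier (endo_ring R K)"
    by (rule endo_carrierI) (use fD assms(1) in auto)
  have "compose (carrier R) f (mult_op R m) = compose (carrier R) (mult_op R m) f" if m: "m \<in> M" for m
    unfolding mult_op_compose[OF fE] compose_mult_op[OF subsetD[OF M m]]
    using fD(4)[OF m] by (rule restrict_ext)
  with fE show "f \<in> centralizer (endo_ring R K) (mult_op R ` M)"
    by (auto simp: centralizer_def)
qed

text \<open>
  A multiplicative map that sends \<open>1\<close> to \<open>1\<close> is \<open>M\<close>-linear if and only if it fixes \<open>M\<close> pointwise.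
\<close>

lemma pointwise_stabilizer_eq:
  assumes "K \<subseteq> M" and M: "M \<subseteq> carrier R"
  shows "pointwise_stabilizer R K M = alg_automorphisms R M"
proof (intro Set.set_eqI iffI)
  fix g assume "g \<in> pointwise_stabilizer R K M"
  then have g: "g \<in> alg_automorphisms R K" and fix_M: "\<And>m. m \<in> M \<Longrightarrow> g m = m"
    by (auto simp: pointwise_stabilizer_def)
  note gD = alg_automorphismsD[OF g]
  have "g \<in> carrier (endo_ring R M)"
  proof (rule endo_carrierI)
    show "g (m \<otimes> x) = m \<otimes> g x" if "m \<in> M" "x \<in> carrier R" for m x
      using ring_hom_mult[OF gD(3), of m x] that M fix_M by auto
  qed (use endo_carrierD[OF gD(1)] in auto)
  with gD(2) show "g \<in> alg_automorphisms R M" by (simp add: alg_automorphisms_def)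
next
  fix g assume g: "g \<in> alg_automorphisms R M"
  note gD = alg_automorphismsD[OF g]
  have "g m = m" if m: "m \<in> M" for m
    using endo_carrierD(4)[OF gD(1) m one_closed] ring_hom_one[OF gD(3)] m M by (simp add: subset_iff)
  moreover have "g \<in> carrier (endo_ring R K)"
    by (rule endo_carrierI) (use endo_carrierD[OF gD(1)] assms(1) in auto)
  ultimately show "g \<in> pointwise_stabilizer R K M"
    using gD(2) by (simp add: pointwise_stabilizer_def alg_automorphisms_def)
qed

lemma endo_subalgebraI:
  assumes "K \<subseteq> carrier R" and A: "subring A (endo_ring R K)" and "mult_op R ` carrier R \<subseteq> A"
  shows "endo_subalgebra R K A"
  using assms subring.axioms(1)[OF A] subringE(6)[OF A]
  by (auto simp: endo_subalgebra_def subalgebra_def subalgebra_axioms_def)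

lemma centralizer_subalgebra_over:
  assumes K: "K \<subseteq> carrier R" and M: "M \<subseteq> carrier R"
  shows "centralizer (endo_ring R K) (mult_op R ` M) \<in> subalgebras_over R K"
proof -
  interpret E: ring "endo_ring R K" using endo_ring_is_ring[OF K] .
  let ?C = "centralizer (endo_ring R K) (mult_op R ` M)"
  have "subring ?C (endo_ring R K)"
    by (rule E.centralizer_is_subring) (use mult_op_closed[OF K] M in auto)
  moreover have "mult_op R ` carrier R \<subseteq> ?C"
  proof (rule image_subsetI)
    fix l assume l: "l \<in> carrier R"
    have "compose (carrier R) (mult_op R l) (mult_op R m) = compose (carrier R) (mult_op R m) (mult_op R l)"
      if "m \<in> M" for m
      using that l M by (auto simp: compose_def mult_op_def m_lcomm subset_iff intro!: restrict_ext)
    then show "mult_op R l \<in> ?C"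
      using mult_op_closed[OF K l] by (auto simp: centralizer_def)
  qed
  ultimately show ?thesis
    using endo_subalgebraI[OF K] by (auto simp: subalgebras_over_def)
qed

text \<open>
  The last three properties say that a subalgebra containing \<open>L\<close> is an \<open>L\<close>-\<open>L\<close>-bimodule, in the form
  used by \<open>bimodule_contains_summands\<close>.
\<close>

lemma subalgebras_overD:
  assumes K: "K \<subseteq> carrier R" and A: "A \<in> subalgebras_over R K"
  shows "subring A (endo_ring R K)"
    and "A \<subseteq> carrier (endo_ring R K)"
    and "f \<in> A \<Longrightarrow> g \<in> A \<Longrightarrow> (\<lambda>x\<in>carrier R. f x \<ominus> g x) \<in> A"
    and "l \<in> carrier R \<Longrightarrow> f \<in> A \<Longrightarrow> (\<lambda>x\<in>carrier R. l \<otimes> f x) \<in> A"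
    and "l \<in> carrier R \<Longrightarrow> f \<in> A \<Longrightarrow> (\<lambda>x\<in>carrier R. f (l \<otimes> x)) \<in> A"
proof -
  show A': "subring A (endo_ring R K)"
    using A by (simp add: subalgebras_over_def endo_subalgebra_def)
  note sub = subringE[OF A']
  show sub1: "A \<subseteq> carrier (endo_ring R K)" by (rule sub(1))
  have L: "mult_op R l \<in> A" if "l \<in> carrier R" for l
    using A that by (auto simp: subalgebras_over_def)
  show "(\<lambda>x\<in>carrier R. l \<otimes> f x) \<in> A" if "l \<in> carrier R" "f \<in> A"
    using sub(6)[OF L[OF that(1)] that(2)] mult_op_compose[of f K l] that sub1 by auto
  show "(\<lambda>x\<in>carrier R. f (l \<otimes> x)) \<in> A" if "l \<in> carrier R" "f \<in> A"
    using sub(6)[OF that(2) L[OF that(1)]] compose_mult_op[of l f] that by auto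
  show "(\<lambda>x\<in>carrier R. f x \<ominus> g x) \<in> A" if "f \<in> A" "g \<in> A"
  proof -
    have "(\<lambda>x\<in>carrier R. \<ominus> g x) \<in> A"
      using sub(5)[OF that(2)] endo_ring_uminus[OF K] that sub1 by auto
    from sub(7)[OF that(1) this] show ?thesis
      by (simp add: minus_eq cong: restrict_cong)
  qed
qed

lemma skew_sum_in_subalgebra:
  assumes K: "K \<subseteq> carrier R" and A: "A \<in> subalgebras_over R K" and "finite F"
    and "F \<subseteq> carrier (endo_ring R K)" and "c \<in> F \<rightarrow> carrier R"
    and "\<And>h. h \<in> F \<Longrightarrow> c h \<noteq> \<zero> \<Longrightarrow> h \<in> A"
  shows "skew_sum R F c \<in> A"
  using assms(3-)
proof (induction F rule: finite_induct)
  case empty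
  have "skew_sum R {} c = \<zero>\<^bsub>endo_ring R K\<^esub>"
    unfolding skew_sum_def endo_ring_simps by (rule restrict_ext) simp
  then show ?case
    using subringE(2)[OF subalgebras_overD(1)[OF K A]] by (simp only:)
next
  case (insert h F)
  note subA = subringE[OF subalgebras_overD(1)[OF K A]]
  have IH: "skew_sum R F c \<in> A"
    using insert.IH insert.prems by blast
  have h: "h \<in> carrier (endo_ring R K)" and ch: "c h \<in> carrier R"
    using insert.prems by auto
  have "skew_sum R (insert h F) c =
    (\<lambda>x\<in>carrier R. c h \<otimes> h x) \<oplus>\<^bsub>endo_ring R K\<^esub> skew_sum R F c"
    unfolding skew_sum_def endo_ring_simps
  proof (rule restrict_ext)
    fix x assume x: "x \<in> carrier R"
    have "(\<lambda>h. c h \<otimes> h x) \<in> F \<rightarrow> carrier R"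
      using insert.prems(1,2) endo_carrierD(2)[of _ R K, OF _ x] by blast
    then show "(\<Oplus>h\<in>insert h F. c h \<otimes> h x) = (\<lambda>x\<in>carrier R. c h \<otimes> h x) x \<oplus>
        (\<lambda>x\<in>carrier R. \<Oplus>h\<in>F. c h \<otimes> h x) x"
      using insert.hyps x ch endo_carrierD(2)[OF h x] by (simp add: finsum_insert)
  qed
  moreover have "(\<lambda>x\<in>carrier R. c h \<otimes> h x) \<in> A"
  proof (cases "c h = \<zero>")
    case True
    have "(\<lambda>x\<in>carrier R. c h \<otimes> h x) = (\<lambda>x\<in>carrier R. \<zero>)"
      by (rule restrict_ext) (simp add: True endo_carrierD(2)[OF h])
    then show ?thesis using subA(2) by (simp only: endo_ring_simps)
  next
    case False
    then show ?thesis using subalgebras_overD(4)[OF K A ch] insert.prems(3) by blast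
  qed
  ultimately show ?case using subA(7) IH by (simp only:)
qed

end

section \<open>Linear functionals\<close>

context field
begin

text \<open>
  By Zorn's lemma \<open>V\<close> lies in a subspace \<open>W\<close> that is maximal among those not containing \<open>l\<close>. Maximality
  makes \<open>W\<close> a complement of the line spanned by \<open>l\<close>: a vector \<open>x\<close> outside \<open>W\<close> satisfies \<open>l = k x + w\<close> with
  \<open>k \<noteq> 0\<close>, and this can be solved for \<open>x\<close>. The functional is the coordinate along \<open>l\<close>.
\<close>

lemma separating_functional:
  assumes M: "subfield M R" and V: "subalgebra M V R" and l: "l \<in> carrier R" "l \<notin> V"
  shows "\<exists>\<phi>\<in>carrier (endo_ring R M). (\<forall>v\<in>V. \<phi> v = \<zero>) \<and> \<phi> l = \<one>"
proof -
  note Mp = subringE[OF subfieldE(1)[OF M]]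
  have Mc: "m \<in> carrier R" if "m \<in> M" for m using Mp(1) that by auto
  define S where "S = {W. subalgebra M W R \<and> V \<subseteq> W \<and> l \<notin> W}"
  have "\<exists>W\<in>S. \<forall>U\<in>S. W \<subseteq> U \<longrightarrow> U = W"
  proof (rule subset_Zorn_nonempty)
    show "S \<noteq> {}" using V l by (auto simp: S_def)
    fix C assume C: "C \<noteq> {}" "subset.chain S C"
    then have sub: "subgroup W (add_monoid R)" and smult: "\<And>k v. k \<in> M \<Longrightarrow> v \<in> W \<Longrightarrow> k \<otimes> v \<in> W"
      and mem: "V \<subseteq> W" "l \<notin> W" if "W \<in> C" for W
      using that subalgebra.axioms(1)[of M W R] subalgebra.smult_closed[of M W R]
      by (auto simp: subset.chain_def S_def)
    have total: "U \<subseteq> Y \<or> Y \<subseteq> U" if "U \<in> C" "Y \<in> C" for U Y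
      using C(2) that by (auto simp: subset.chain_def)
    have "subgroup (\<Union>C) (add_monoid R)"
    proof (rule add.subgroupI)
      show "\<Union>C \<subseteq> carrier R" using add.subgroupE(1)[OF sub] by blast
      show "\<Union>C \<noteq> {}" using C(1) add.subgroupE(2)[OF sub] by blast
      show "\<ominus> a \<in> \<Union>C" if "a \<in> \<Union>C" for a
        using that add.subgroupE(3)[OF sub] by blast
      show "a \<oplus> b \<in> \<Union>C" if ab: "a \<in> \<Union>C" "b \<in> \<Union>C" for a b
      proof -
        obtain U Y where UY: "U \<in> C" "a \<in> U" "Y \<in> C" "b \<in> Y" using ab by blast
        obtain Z where Z: "Z \<in> C" "a \<in> Z" "b \<in> Z"
          using total[OF UY(1,3)] UY by blast
        then show ?thesis using add.subgroupE(4)[OF sub[OF Z(1)] Z(2,3)] Z(1) by blast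
      qed
    qed
    moreover have "k \<otimes> v \<in> \<Union>C" if "k \<in> M" "v \<in> \<Union>C" for k v
      using that smult by blast
    ultimately have "subalgebra M (\<Union>C) R"
      by (simp add: subalgebra_def subalgebra_axioms_def)
    then show "\<Union>C \<in> S" using mem C(1) by (auto simp: S_def)
  qed
  then obtain W where WS: "W \<in> S" and WS_max: "\<And>U. U \<in> S \<Longrightarrow> W \<subseteq> U \<Longrightarrow> U = W"
    by blast
  have W: "subalgebra M W R" "V \<subseteq> W" "l \<notin> W"
    using WS by (simp_all add: S_def)
  have max: "U = W" if "subalgebra M U R" "W \<subseteq> U" "l \<notin> U" for U
    using WS_max[of U] that W(2) by (auto simp: S_def)
  note Wg = subalgebra.axioms(1)[OF W(1)] and Wm = subalgebra.smult_closed[OF W(1)]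
  note Wp = add.subgroupE[OF Wg]
  have Wc: "w \<in> carrier R" if "w \<in> W" for w using Wp(1) that by auto
  have W0: "\<zero> \<in> W" using subgroup.one_closed[OF Wg] by simp

  have ex: "\<exists>m\<in>M. x \<ominus> m \<otimes> l \<in> W" if x: "x \<in> carrier R" for x
  proof (cases "x \<in> W")
    case True
    then have "x \<ominus> \<zero> \<otimes> l \<in> W" using x l by (simp add: minus_eq)
    then show ?thesis using Mp(2) by blast
  next
    case False
    let ?U = "line_extension M x W"
    have "subalgebra M ?U R"
      using line_extension_is_subgroup[OF M Wg x]
        line_extension_smult_closed[OF M Wm Wp(1) x]
      by (simp add: subalgebra_def subalgebra_axioms_def)
    moreover have "W \<subseteq> ?U"
    proof
      fix w assume w: "w \<in> W"
      then have "w = \<zero> \<otimes> x \<oplus> w" using x Wc by simp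
      then show "w \<in> ?U" using Mp(2) w line_extension_mem_iff by blast
    qed
    moreover have "x \<in> ?U"
    proof -
      have "x = \<one> \<otimes> x \<oplus> \<zero>" using x by simp
      then show ?thesis using Mp(3) W0 line_extension_mem_iff by blast
    qed
    ultimately have "l \<in> ?U" using max False by blast
    then obtain k w where kw: "k \<in> M" "w \<in> W" "l = k \<otimes> x \<oplus> w"
      using line_extension_mem_iff by blast
    have "k \<noteq> \<zero>" using kw W(3) x Wc by auto
    then have k: "inv k \<in> M" "inv k \<otimes> k = \<one>"
      using subfield_m_inv[OF M, of k] kw(1) by auto
    have cl: "k \<in> carrier R" "inv k \<in> carrier R" "w \<in> carrier R"
      using Mc kw k Wc by auto
    have "inv k \<otimes> l = (inv k \<otimes> k) \<otimes> x \<oplus> inv k \<otimes> w"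
      using kw(3) cl x by (simp add: r_distr m_assoc)
    then have "x \<ominus> inv k \<otimes> l = \<ominus> (inv k \<otimes> w)"
      using k(2) cl x by (simp add: minus_eq minus_add r_neg1 r_neg a_assoc[symmetric])
    then have "x \<ominus> inv k \<otimes> l \<in> W" using Wp(3)[OF Wm[OF k(1) kw(2)]] by (simp only:)
    then show ?thesis using k(1) by (rule bexI)
  qed
  have uniq: "m = n"
    if mn: "m \<in> M" "n \<in> M" "x \<in> carrier R" "x \<ominus> m \<otimes> l \<in> W" "x \<ominus> n \<otimes> l \<in> W" for m n x
  proof (rule ccontr)
    assume "m \<noteq> n"
    have cl: "m \<in> carrier R" "n \<in> carrier R" using Mc mn by auto
    let ?d = "m \<ominus> n"
    have d: "?d \<in> M" "?d \<noteq> \<zero>" "?d \<in> carrier R"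
      using Mp mn cl \<open>m \<noteq> n\<close> by (auto simp: minus_eq r_right_minus_eq[unfolded minus_eq])
    have "?d \<otimes> l = (x \<ominus> n \<otimes> l) \<oplus> \<ominus> (x \<ominus> m \<otimes> l)"
      using cl mn(3) l(1) by algebra
    then have "?d \<otimes> l \<in> W" using Wp(3,4) mn(4,5) by simp
    then have "inv ?d \<otimes> (?d \<otimes> l) \<in> W"
      using subfield_m_inv(1)[OF M, of ?d] d Wm by auto
    moreover have "inv ?d \<otimes> (?d \<otimes> l) = l"
      using subfield_m_inv[OF M, of ?d] d l Mc by (auto simp: m_assoc[symmetric])
    ultimately show False using W(3) by simp
  qed
  define \<phi> where "\<phi> = (\<lambda>x\<in>carrier R. THE m. m \<in> M \<and> x \<ominus> m \<otimes> l \<in> W)"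
  have \<phi>I: "\<phi> x = m" if "x \<in> carrier R" "m \<in> M" "x \<ominus> m \<otimes> l \<in> W" for x m
    using that uniq by (auto simp: \<phi>_def intro!: the_equality)
  have \<phi>: "\<phi> x \<in> M" "x \<ominus> \<phi> x \<otimes> l \<in> W" if x: "x \<in> carrier R" for x
    using ex[OF x] \<phi>I[OF x] by auto
  have \<phi>c: "\<phi> x \<in> carrier R" if "x \<in> carrier R" for x using Mc \<phi>(1) that by auto
  have "\<phi> \<in> carrier (endo_ring R M)"
  proof (rule endo_carrierI)
    show "\<phi> (x \<oplus> y) = \<phi> x \<oplus> \<phi> y" if xy: "x \<in> carrier R" "y \<in> carrier R" for x y
    proof (rule \<phi>I)
      have "x \<oplus> y \<ominus> (\<phi> x \<oplus> \<phi> y) \<otimes> l = (x \<ominus> \<phi> x \<otimes> l) \<oplus> (y \<ominus> \<phi> y \<otimes> l)"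
        using xy \<phi>c[OF xy(1)] \<phi>c[OF xy(2)] l(1) by algebra
      then show "x \<oplus> y \<ominus> (\<phi> x \<oplus> \<phi> y) \<otimes> l \<in> W"
        using Wp(4)[OF \<phi>(2)[OF xy(1)] \<phi>(2)[OF xy(2)]] by simp
    qed (use xy \<phi> Mp in auto)
    show "\<phi> (m \<otimes> x) = m \<otimes> \<phi> x" if mx: "m \<in> M" "x \<in> carrier R" for m x
    proof (rule \<phi>I)
      have "m \<otimes> x \<ominus> (m \<otimes> \<phi> x) \<otimes> l = m \<otimes> (x \<ominus> \<phi> x \<otimes> l)"
        using mx \<phi>c[OF mx(2)] Mc[OF mx(1)] l(1) by algebra
      then show "m \<otimes> x \<ominus> (m \<otimes> \<phi> x) \<otimes> l \<in> W"
        using Wm[OF mx(1) \<phi>(2)[OF mx(2)]] by simp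
    qed (use mx \<phi> Mp Mc in auto)
  qed (use \<phi>c in \<open>auto simp: \<phi>_def\<close>)
  moreover have "\<phi> v = \<zero>" if "v \<in> V" for v
  proof (rule \<phi>I)
    have v: "v \<in> W" "v \<in> carrier R" using that W(2) Wc by auto
    then show "v \<in> carrier R" "v \<ominus> \<zero> \<otimes> l \<in> W" using l by (auto simp: minus_eq)
  qed (rule Mp(2))
  moreover have "\<phi> l = \<one>"
    by (rule \<phi>I) (use l Mp(3) W0 in \<open>auto simp: minus_eq r_neg\<close>)
  ultimately show ?thesis by blast
qed

end

section \<open>Automorphisms that fix the fixed field of a finite monoid\<close>

context field
begin

lemma compose_inj_on_automorphisms:
  assumes g: "g \<in> alg_automorphisms R K"
  shows "inj_on (compose (carrier R) g) (alg_automorphisms R K)"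
proof (rule inj_onI)
  fix f h assume f: "f \<in> alg_automorphisms R K" and h: "h \<in> alg_automorphisms R K"
    and eq: "compose (carrier R) g f = compose (carrier R) g h"
  note inj = bij_betw_imp_inj_on[OF alg_automorphismsD(5)[OF g]]
  show "f = h"
  proof (rule extensionalityI[of _ "carrier R"])
    fix x assume x: "x \<in> carrier R"
    have "g (f x) = g (h x)" using fun_cong[OF eq, of x] x by (simp add: compose_def)
    then show "f x = h x"
      by (rule inj_onD[OF inj])
        (simp_all add: ring_hom_closed[OF alg_automorphismsD(3)[OF f] x]
          ring_hom_closed[OF alg_automorphismsD(3)[OF h] x])
  qed (use f h alg_automorphismsD(4) in auto)
qed

lemma finsum_translate:
  assumes g: "g \<in> alg_automorphisms R K" and H: "H \<subseteq> alg_automorphisms R K" and x: "x \<in> carrier R"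
  shows "g (\<Oplus>h\<in>H. h x) = (\<Oplus>f\<in>compose (carrier R) g ` H. f x)"
proof -
  interpret g: ring_hom_cring R R g
    using alg_automorphismsD(3)[OF g] by (intro ring_hom_cring.intro is_cring) (simp add: ring_hom_cring_axioms_def)
  have hx: "h x \<in> carrier R" if "h \<in> H" for h
    using ring_hom_closed[OF alg_automorphismsD(3)[OF subsetD[OF H that]] x] .
  have comp: "compose (carrier R) g h x = g (h x)" for h
    using x by (simp add: compose_def)
  have "g (\<Oplus>h\<in>H. h x) = (\<Oplus>h\<in>H. g (h x))"
    using hx g.hom_finsum[of "\<lambda>h. h x" H] by (auto simp: comp_def)
  also have "\<dots> = (\<Oplus>h\<in>H. compose (carrier R) g h x)"
    by (simp add: comp)
  also have "\<dots> = (\<Oplus>f\<in>compose (carrier R) g ` H. f x)"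
  proof (rule finsum_reindex[symmetric])
    show "(\<lambda>f. f x) \<in> compose (carrier R) g ` H \<rightarrow> carrier R"
      using hx by (auto simp: comp)
    show "inj_on (compose (carrier R) g) H"
      using inj_on_subset[OF compose_inj_on_automorphisms[OF g] H] .
  qed
  finally show ?thesis .
qed

text \<open>
  The difference of the two sums is a vanishing combination of the elements of \<open>F \<union> H\<close>, whose
  coefficients are the differences of the indicator functions \<open>\<chi>\<close> of \<open>F\<close> and \<open>H\<close>.
\<close>

lemma finsum_determines_set:
  assumes "finite F" "finite H" and F: "F \<subseteq> ring_hom R R \<inter> extensional (carrier R)"
    and H: "H \<subseteq> ring_hom R R \<inter> extensional (carrier R)"
    and eq: "\<And>x. x \<in> carrier R \<Longrightarrow> (\<Oplus>h\<in>F. h x) = (\<Oplus>h\<in>H. h x)"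
  shows "F \<subseteq> H"
proof
  fix f assume f: "f \<in> F"
  define \<chi> where "\<chi> S = (\<lambda>h. if h \<in> S then \<one> else \<zero>)" for S :: "('a \<Rightarrow> 'a) set"
  let ?U = "F \<union> H"
  have hx: "h x \<in> carrier R" if "h \<in> ?U" "x \<in> carrier R" for h x
  proof -
    have "h \<in> ring_hom R R" using that(1) F H by blast
    then show ?thesis using that(2) by (rule ring_hom_closed)
  qed
  have chi_cl: "\<chi> S h \<in> carrier R" for S h by (simp add: \<chi>_def)
  have chi: "(\<Oplus>h\<in>?U. \<chi> S h \<otimes> h x) = (\<Oplus>h\<in>S. h x)" if S: "S \<subseteq> ?U" and x: "x \<in> carrier R" for S x
  proof (rule add.finprod_mono_neutral_cong_right)
    show "finite ?U" using assms(1,2) by simp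
    show "S \<subseteq> ?U" by (rule S)
    show "\<chi> S h \<otimes> h x = \<zero>" if "h \<in> ?U - S" for h
      using that hx[of h, OF _ x] by (simp add: \<chi>_def)
    show "\<chi> S h \<otimes> h x = h x" if "h \<in> S" for h
      using that hx[of h, OF subsetD[OF S that] x] by (simp add: \<chi>_def)
    show "(\<lambda>h. \<chi> S h \<otimes> h x) \<in> ?U \<rightarrow> carrier R"
      using chi_cl hx[OF _ x] by (intro Pi_I m_closed)
  qed
  have "\<chi> F f \<ominus> \<chi> H f = \<zero>"
  proof (rule ring_homs_linearly_independent[where F = "F \<union> H" and c = "\<lambda>h. \<chi> F h \<ominus> \<chi> H h"])
    show "finite ?U" "?U \<subseteq> ring_hom R R \<inter> extensional (carrier R)" "f \<in> ?U"
      using assms f by auto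
    show "(\<lambda>h. \<chi> F h \<ominus> \<chi> H h) \<in> ?U \<rightarrow> carrier R" by (auto simp: \<chi>_def)
    fix x assume x: "x \<in> carrier R"
    have cl: "(\<Oplus>h\<in>H. h x) \<in> carrier R" using hx[OF _ x] by (intro finsum_closed Pi_I) simp
    have "(\<Oplus>h\<in>?U. (\<chi> F h \<ominus> \<chi> H h) \<otimes> h x) = (\<Oplus>h\<in>?U. \<chi> F h \<otimes> h x \<oplus> (\<ominus> \<one>) \<otimes> (\<chi> H h \<otimes> h x))"
    proof (rule finsum_cong')
      fix h assume h: "h \<in> ?U"
      show "(\<chi> F h \<ominus> \<chi> H h) \<otimes> h x = \<chi> F h \<otimes> h x \<oplus> (\<ominus> \<one>) \<otimes> (\<chi> H h \<otimes> h x)"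
        using hx[OF h x] chi_cl[of F h] chi_cl[of H h] by algebra
    next
      show "(\<lambda>h. \<chi> F h \<otimes> h x \<oplus> (\<ominus> \<one>) \<otimes> (\<chi> H h \<otimes> h x)) \<in> ?U \<rightarrow> carrier R"
        using chi_cl hx[OF _ x] by (intro Pi_I a_closed m_closed) simp_all
    qed simp
    also have "\<dots> = (\<Oplus>h\<in>?U. \<chi> F h \<otimes> h x) \<oplus> (\<ominus> \<one>) \<otimes> (\<Oplus>h\<in>?U. \<chi> H h \<otimes> h x)"
    proof -
      have cl: "(\<lambda>h. \<chi> S h \<otimes> h x) \<in> ?U \<rightarrow> carrier R" for S
        using chi_cl hx[OF _ x] by (intro Pi_I m_closed)
      have "(\<lambda>h. (\<ominus> \<one>) \<otimes> (\<chi> H h \<otimes> h x)) \<in> ?U \<rightarrow> carrier R"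
        using chi_cl hx[OF _ x] by (intro Pi_I m_closed) simp_all
      moreover have "finite ?U" using assms(1,2) by simp
      ultimately show ?thesis
        using cl by (simp only: finsum_addf finsum_rdistr a_inv_closed one_closed)
    qed
    also have "\<dots> = \<zero>"
      using chi[of F x] chi[of H x] eq[OF x] cl x by (simp add: l_minus r_neg)
    finally show "(\<Oplus>h\<in>?U. (\<chi> F h \<ominus> \<chi> H h) \<otimes> h x) = \<zero>" .
  qed
  then show "f \<in> H" using f by (auto simp: \<chi>_def minus_eq split: if_splits)
qed

text \<open>
  A form of Artin's theorem. The trace over \<open>H\<close> takes values in the fixed field because a left
  translation by an element of \<open>H\<close> permutes \<open>H\<close>. Hence \<open>g\<close> does not change the trace, so the sums over
  \<open>g H\<close> and over \<open>H\<close> agree and \<open>g H \<subseteq> H\<close>.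
\<close>

lemma stabilizer_of_fixed_field:
  assumes fin: "finite H" and H: "H \<subseteq> alg_automorphisms R K"
    and one: "(\<lambda>x\<in>carrier R. x) \<in> H"
    and comp: "\<And>f h. f \<in> H \<Longrightarrow> h \<in> H \<Longrightarrow> compose (carrier R) f h \<in> H"
    and g: "g \<in> alg_automorphisms R K" and fixed: "\<And>l. l \<in> fixed_field R H \<Longrightarrow> g l = l"
  shows "g \<in> H"
proof -
  have cl: "(\<Oplus>h\<in>H. h x) \<in> carrier R" if x: "x \<in> carrier R" for x
    using ring_hom_closed[OF alg_automorphismsD(3)[OF subsetD[OF H]] x] by (intro finsum_closed Pi_I)
  have trace: "(\<Oplus>h\<in>H. h x) \<in> fixed_field R H" if x: "x \<in> carrier R" for x
  proof -
    have "k (\<Oplus>h\<in>H. h x) = (\<Oplus>h\<in>H. h x)" if k: "k \<in> H" for k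
    proof -
      have "compose (carrier R) k ` H = H"
      proof (rule endo_inj_surj[OF fin])
        show "compose (carrier R) k ` H \<subseteq> H" using comp[OF k] by blast
        show "inj_on (compose (carrier R) k) H"
          using inj_on_subset[OF compose_inj_on_automorphisms[OF subsetD[OF H k]] H] .
      qed
      then show ?thesis using finsum_translate[OF _ H x, of k] k H by auto
    qed
    then show ?thesis using cl[OF x] by (simp add: fixed_field_def)
  qed
  have aut: "compose (carrier R) g h \<in> ring_hom R R \<inter> extensional (carrier R)" if h: "h \<in> H" for h
  proof -
    have "g \<circ> h \<in> ring_hom R R"
      using ring_hom_trans alg_automorphismsD(3)[OF g] alg_automorphismsD(3)[of h R K] H h by blast
    then have "compose (carrier R) g h \<in> ring_hom R R"
      by (rule ring_hom_restrict) (simp add: compose_def)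
    then show ?thesis by (simp add: compose_def)
  qed
  have "compose (carrier R) g ` H \<subseteq> H"
  proof (rule finsum_determines_set)
    show "(\<Oplus>f\<in>compose (carrier R) g ` H. f x) = (\<Oplus>h\<in>H. h x)" if x: "x \<in> carrier R" for x
      using finsum_translate[OF g H x] fixed[OF trace[OF x]] by simp
    show "H \<subseteq> ring_hom R R \<inter> extensional (carrier R)"
      using H alg_automorphismsD(3,4)[of _ R K] by blast
  qed (use fin aut in auto)
  then have "compose (carrier R) g (\<lambda>x\<in>carrier R. x) \<in> H" using one by blast
  moreover have "compose (carrier R) g (\<lambda>x\<in>carrier R. x) = g"
    using alg_automorphismsD(4)[OF g] by (auto simp: compose_def extensional_def)
  ultimately show ?thesis by simp
qed

end

section \<open>Subalgebras of a G-extension\<close>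

locale G_extension_field = field L for L (structure) +
  fixes K
  assumes G_extension: "G_extension L K"
begin

abbreviation "E \<equiv> endo_ring L K"
abbreviation "G \<equiv> alg_automorphisms L K"
abbreviation "\<A> \<equiv> subalgebras_over L K"

lemma base_field: "subfield K L" "K \<subseteq> carrier L"
  using G_extension subfieldE(3) by (auto simp: G_extension_def)

lemma finite_G: "finite G"
  using alg_automorphisms_finite[OF base_field(1)] G_extension by (simp add: G_extension_def)

sublocale E: ring E
  using endo_ring_is_ring[OF base_field(2)] .

lemma G_subset_E: "G \<subseteq> carrier E"
  using alg_automorphismsD(1) by blast

lemma G_subgroup: "subgroup G (BijGroup (carrier L))"
  by (rule alg_automorphisms_subgroup[OF base_field(2)])

lemma compose_in_G:
  assumes "g \<in> G" "h \<in> G" shows "compose (carrier L) g h \<in> G"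
  using subgroup.m_closed[OF G_subgroup assms] subgroup.mem_carrier[OF G_subgroup] assms
  by (simp add: BijGroup_def)

lemma id_in_G: "(\<lambda>x\<in>carrier L. x) \<in> G"
  using subgroup.one_closed[OF G_subgroup] by (simp add: BijGroup_def)

text \<open>
  The set \<open>S\<close> of sums \<open>\<Sum>\<^sub>G c\<^sub>h h\<close> is an additive group that is stable under left multiplication by \<open>L\<close>
  and by \<open>G\<close>. The endomorphisms \<open>f\<close> with \<open>f S \<subseteq> S\<close> always form a subring, so it is all of \<open>E\<close> as soon
  as it contains \<open>L\<close> and \<open>G\<close>; then \<open>f = f 1\<close> lies in \<open>S\<close>. This avoids multiplying two sums.
\<close>

lemma endo_is_skew_sum:
  assumes "f \<in> carrier E"
  shows "\<exists>c\<in>G \<rightarrow> carrier L. f = skew_sum L G c"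
proof -
  define S where "S = skew_sum L G ` (G \<rightarrow> carrier L)"
  have SI: "f \<in> S" if "c \<in> G \<rightarrow> carrier L" "f \<in> extensional (carrier L)"
    "\<And>x. x \<in> carrier L \<Longrightarrow> f x = (\<Oplus>h\<in>G. c h \<otimes> h x)" for f c
    unfolding S_def
  proof (rule image_eqI[OF _ that(1)])
    show "f = skew_sum L G c"
      by (rule extensionalityI[OF that(2)]) (simp_all add: skew_sum_def that(3))
  qed
  have Gx: "h x \<in> carrier L" if "h \<in> G" "x \<in> carrier L" for h x
    using endo_carrierD(2)[OF subsetD[OF G_subset_E that(1)] that(2)] .
  have SD: "\<exists>c. c \<in> G \<rightarrow> carrier L \<and> (\<forall>x\<in>carrier L. s x = (\<Oplus>h\<in>G. c h \<otimes> h x))" if "s \<in> S" for s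
    using that by (auto simp: S_def skew_sum_def)
  have S_E: "s \<in> carrier E" if "s \<in> S" for s
    using that skew_sum_closed[OF base_field(2) G_subset_E] by (auto simp: S_def)
  have term_cl: "(\<lambda>h. c h \<otimes> h x) \<in> G \<rightarrow> carrier L" if "c \<in> G \<rightarrow> carrier L" "x \<in> carrier L" for c x
    using funcset_mem[OF that(1)] Gx[OF _ that(2)] by (intro Pi_I m_closed)
  have S_add: "s \<oplus>\<^bsub>E\<^esub> t \<in> S" if s: "s \<in> S" and t: "t \<in> S" for s t
  proof -
    obtain c d where c: "c \<in> G \<rightarrow> carrier L" "\<forall>x\<in>carrier L. s x = (\<Oplus>h\<in>G. c h \<otimes> h x)"
      and d: "d \<in> G \<rightarrow> carrier L" "\<forall>x\<in>carrier L. t x = (\<Oplus>h\<in>G. d h \<otimes> h x)"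
      using SD[OF s] SD[OF t] by blast
    show ?thesis
    proof (rule SI)
      show "(\<lambda>h. c h \<oplus> d h) \<in> G \<rightarrow> carrier L"
        using funcset_mem[OF c(1)] funcset_mem[OF d(1)] by (intro Pi_I a_closed)
      fix x assume x: "x \<in> carrier L"
      have "(\<Oplus>h\<in>G. (c h \<oplus> d h) \<otimes> h x) = (\<Oplus>h\<in>G. c h \<otimes> h x \<oplus> d h \<otimes> h x)"
      proof (rule finsum_cong')
        show "(\<lambda>h. c h \<otimes> h x \<oplus> d h \<otimes> h x) \<in> G \<rightarrow> carrier L"
          using funcset_mem[OF term_cl[OF c(1) x]] funcset_mem[OF term_cl[OF d(1) x]] by (intro Pi_I a_closed)
        show "(c h \<oplus> d h) \<otimes> h x = c h \<otimes> h x \<oplus> d h \<otimes> h x" if "h \<in> G" for h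
          using funcset_mem[OF c(1) that] funcset_mem[OF d(1) that] Gx[OF that x] by (rule l_distr)
      qed simp
      also have "\<dots> = s x \<oplus> t x"
        using c(2) d(2) x finsum_addf[OF term_cl[OF c(1) x] term_cl[OF d(1) x]] by simp
      finally show "(s \<oplus>\<^bsub>E\<^esub> t) x = (\<Oplus>h\<in>G. (c h \<oplus> d h) \<otimes> h x)"
        using x by simp
    qed simp
  qed
  have S_mult: "mult_op L l \<otimes>\<^bsub>E\<^esub> s \<in> S" if l: "l \<in> carrier L" and s: "s \<in> S" for l s
  proof -
    obtain c where c: "c \<in> G \<rightarrow> carrier L" "\<forall>x\<in>carrier L. s x = (\<Oplus>h\<in>G. c h \<otimes> h x)"
      using SD[OF s] by blast
    show ?thesis
    proof (rule SI)
      show "(\<lambda>h. l \<otimes> c h) \<in> G \<rightarrow> carrier L"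
        using funcset_mem[OF c(1)] l by (intro Pi_I m_closed)
      fix x assume x: "x \<in> carrier L"
      have "(\<Oplus>h\<in>G. (l \<otimes> c h) \<otimes> h x) = (\<Oplus>h\<in>G. l \<otimes> (c h \<otimes> h x))"
      proof (rule finsum_cong')
        show "(\<lambda>h. l \<otimes> (c h \<otimes> h x)) \<in> G \<rightarrow> carrier L"
          by (intro Pi_I m_closed[OF l funcset_mem[OF term_cl[OF c(1) x]]])
        show "(l \<otimes> c h) \<otimes> h x = l \<otimes> (c h \<otimes> h x)" if "h \<in> G" for h
          using l funcset_mem[OF c(1) that] Gx[OF that x] by (rule m_assoc)
      qed simp
      also have "\<dots> = l \<otimes> s x"
        using c(2) x finsum_rdistr[OF finite_G l term_cl[OF c(1) x]] by simp
      finally show "(mult_op L l \<otimes>\<^bsub>E\<^esub> s) x = (\<Oplus>h\<in>G. (l \<otimes> c h) \<otimes> h x)"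
        using x mult_op_compose[OF S_E[OF s], of l] by simp
    qed (simp add: compose_def)
  qed
  have S_translate: "g \<otimes>\<^bsub>E\<^esub> s \<in> S" if g: "g \<in> G" and s: "s \<in> S" for g s
  proof -
    obtain c where c: "c \<in> G \<rightarrow> carrier L" "\<forall>x\<in>carrier L. s x = (\<Oplus>h\<in>G. c h \<otimes> h x)"
      using SD[OF s] by blast
    interpret g: ring_hom_cring L L g
      using alg_automorphismsD(3)[OF g] by (intro ring_hom_cring.intro is_cring) (simp add: ring_hom_cring_axioms_def)
    let ?t = "compose (carrier L) g"
    have inj: "inj_on ?t G" by (rule compose_inj_on_automorphisms[OF g])
    have img: "?t ` G = G"
      by (rule endo_inj_surj[OF finite_G _ inj]) (use compose_in_G[OF g] in blast)
    let ?r = "the_inv_into G ?t"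
    have r: "?r h \<in> G" if "h \<in> G" for h
      using the_inv_into_into[OF inj, of h G] that img by simp
    have rt: "?r (?t h) = h" if "h \<in> G" for h
      by (rule the_inv_into_f_f[OF inj that])
    \<comment> \<open>From \<open>g (c\<^sub>h h) = g(c\<^sub>h) (g h)\<close>, reindexed by \<open>g h\<close>.\<close>
    define d where "d = (\<lambda>h. g (c (?r h)))"
    show ?thesis
    proof (rule SI)
      show dG: "d \<in> G \<rightarrow> carrier L"
        using g.hom_closed[OF funcset_mem[OF c(1) r]] by (auto simp: d_def)
      fix x assume x: "x \<in> carrier L"
      have "(\<Oplus>h\<in>G. d h \<otimes> h x) = (\<Oplus>h\<in>?t ` G. d h \<otimes> h x)" by (simp add: img)
      also have "\<dots> = (\<Oplus>h\<in>G. d (?t h) \<otimes> ?t h x)"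
        using term_cl[OF dG x] by (intro finsum_reindex inj) (simp add: img)
      also have "\<dots> = (\<Oplus>h\<in>G. g (c h \<otimes> h x))"
      proof (rule finsum_cong')
        show "(\<lambda>h. g (c h \<otimes> h x)) \<in> G \<rightarrow> carrier L"
          using g.hom_closed[OF funcset_mem[OF term_cl[OF c(1) x]]] by (intro Pi_I)
        show "d (?t h) \<otimes> ?t h x = g (c h \<otimes> h x)" if h: "h \<in> G" for h
          using g.hom_mult[OF funcset_mem[OF c(1) h] Gx[OF h x]] x
          by (simp add: d_def rt[OF h]) (simp add: compose_def)
      qed simp
      also have "\<dots> = g (\<Oplus>h\<in>G. c h \<otimes> h x)"
        using g.hom_finsum[OF term_cl[OF c(1) x]] by (simp add: comp_def)
      also have "\<dots> = (g \<otimes>\<^bsub>E\<^esub> s) x"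
        using c(2) x by (simp add: compose_def)
      finally show "(g \<otimes>\<^bsub>E\<^esub> s) x = (\<Oplus>h\<in>G. d h \<otimes> h x)" by simp
    qed (simp add: compose_def)
  qed
  have S_one: "\<one>\<^bsub>E\<^esub> \<in> S"
  proof (rule SI)
    let ?i = "\<lambda>x\<in>carrier L. x"
    let ?c = "\<lambda>h. if ?i = h then \<one> else \<zero>"
    show "?c \<in> G \<rightarrow> carrier L" by auto
    fix x assume x: "x \<in> carrier L"
    have "(\<Oplus>h\<in>G. ?c h \<otimes> h x) = (\<Oplus>h\<in>G. if ?i = h then h x else \<zero>)"
    proof (rule finsum_cong')
      show "(\<lambda>h. if ?i = h then h x else \<zero>) \<in> G \<rightarrow> carrier L"
        using Gx[OF _ x] by (intro Pi_I) (simp split: if_split)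
      show "?c h \<otimes> h x = (if ?i = h then h x else \<zero>)" if "h \<in> G" for h
        using Gx[OF that x] by simp
    qed simp
    also have "\<dots> = ?i x"
      by (rule finsum_singleton[OF id_in_G finite_G]) (use Gx[OF _ x] in \<open>intro Pi_I\<close>)
    finally show "\<one>\<^bsub>E\<^esub> x = (\<Oplus>h\<in>G. ?c h \<otimes> h x)" by (simp only: endo_ring_simps)
  qed simp
  have S_uminus: "\<ominus>\<^bsub>E\<^esub> s \<in> S" if s: "s \<in> S" for s
  proof -
    have "\<ominus>\<^bsub>E\<^esub> s = mult_op L (\<ominus> \<one>) \<otimes>\<^bsub>E\<^esub> s"
      unfolding endo_ring_uminus[OF base_field(2) S_E[OF s]] endo_ring_simps mult_op_compose[OF S_E[OF s]]
      by (rule restrict_ext) (simp add: l_minus endo_carrierD(2)[OF S_E[OF s]])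
    then show ?thesis using S_mult[OF _ s] by simp
  qed
  define N where "N = {f \<in> carrier E. \<forall>s\<in>S. f \<otimes>\<^bsub>E\<^esub> s \<in> S}"
  have NI: "f \<in> N" if "f \<in> carrier E" "\<And>s. s \<in> S \<Longrightarrow> f \<otimes>\<^bsub>E\<^esub> s \<in> S" for f
    using that by (simp add: N_def)
  have ND: "f \<in> carrier E" "s \<in> S \<Longrightarrow> f \<otimes>\<^bsub>E\<^esub> s \<in> S" if "f \<in> N" for f s
    using that by (simp_all add: N_def)
  have N_L: "mult_op L ` carrier L \<subseteq> N"
    by (rule image_subsetI, rule NI) (use mult_op_closed[OF base_field(2)] S_mult in blast)+
  have "subring N E"
  proof (rule E.subringI)
    show "N \<subseteq> carrier E" using ND(1) by blast
    show "\<one>\<^bsub>E\<^esub> \<in> N"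
      by (rule NI[OF E.one_closed]) (simp only: E.l_one S_E)
    show "\<ominus>\<^bsub>E\<^esub> f \<in> N" if f: "f \<in> N" for f
      by (rule NI[OF E.a_inv_closed[OF ND(1)[OF f]]])
        (simp only: E.l_minus ND(1)[OF f] S_E S_uminus ND(2)[OF f])
    show "f \<otimes>\<^bsub>E\<^esub> g \<in> N" if f: "f \<in> N" and g: "g \<in> N" for f g
      by (rule NI[OF E.m_closed[OF ND(1)[OF f] ND(1)[OF g]]])
        (simp only: E.m_assoc ND(1)[OF f] ND(1)[OF g] S_E ND(2)[OF f] ND(2)[OF g])
    show "f \<oplus>\<^bsub>E\<^esub> g \<in> N" if f: "f \<in> N" and g: "g \<in> N" for f g
      by (rule NI[OF E.a_closed[OF ND(1)[OF f] ND(1)[OF g]]])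
        (simp only: E.l_distr ND(1)[OF f] ND(1)[OF g] S_E S_add ND(2)[OF f] ND(2)[OF g])
  qed
  then have "endo_subalgebra L K N"
    using endo_subalgebraI[OF base_field(2) _ N_L] by blast
  moreover have "G \<subseteq> N"
    using NI G_subset_E S_translate by blast
  ultimately have "skew_algebra L K G \<subseteq> N"
    unfolding skew_algebra_def using N_L by (intro hull_minimal Un_least)
  moreover have "carrier E = skew_algebra L K G"
    using G_extension by (simp add: G_extension_def)
  ultimately have "f \<in> N" using assms by blast
  then have "f \<otimes>\<^bsub>E\<^esub> \<one>\<^bsub>E\<^esub> \<in> S" using ND(2) S_one by blast
  then have "f \<in> S" using E.r_one[OF assms] by (simp only:)
  then show ?thesis by (auto simp: S_def)
qed

text \<open>
  Write an element of \<open>A\<close> as a sum \<open>\<Sum>\<^sub>G c\<^sub>h h\<close>. As \<open>A\<close> is a bimodule, the automorphisms that occur with a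
  nonzero coefficient belong to \<open>A\<close>, so the element lies in each subalgebra that contains \<open>L\<close> and \<open>A \<inter> G\<close>.
\<close>

lemma subalgebra_eq_skew_algebra:
  assumes A: "A \<in> \<A>"
  shows "A = skew_algebra L K (A \<inter> G)"
proof
  show "skew_algebra L K (A \<inter> G) \<subseteq> A"
    unfolding skew_algebra_def using A by (intro hull_minimal) (auto simp: subalgebras_over_def)
  show "A \<subseteq> skew_algebra L K (A \<inter> G)"
    unfolding skew_algebra_def hull_def
  proof (intro subsetI InterI, clarify)
    fix a B assume a: "a \<in> A" and B: "endo_subalgebra L K B" "mult_op L ` carrier L \<union> A \<inter> G \<subseteq> B"
    have "B \<in> \<A>" using B by (simp add: subalgebras_over_def)
    have "a \<in> carrier E" using a subalgebras_overD(2)[OF base_field(2) A] by blast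
    from endo_is_skew_sum[OF this] obtain c where c: "c \<in> G \<rightarrow> carrier L" "a = skew_sum L G c" by blast
    have hom: "G \<subseteq> ring_hom L L \<inter> extensional (carrier L)"
      using alg_automorphismsD(3,4)[of _ L K] by blast
    have "h \<in> A" if "h \<in> G" "c h \<noteq> \<zero>" for h
      by (rule bimodule_contains_summands[OF subalgebras_overD(3,4,5)[OF base_field(2) A] finite_G hom c(1) _ that])
        (use a c(2) in simp_all)
    then have "h \<in> B" if "h \<in> G" "c h \<noteq> \<zero>" for h
      using that B(2) by blast
    then show "a \<in> B"
      unfolding c(2) by (intro skew_sum_in_subalgebra[OF base_field(2) \<open>B \<in> \<A>\<close> finite_G G_subset_E c(1)])
  qed
qed

end

section \<open>The correspondence\<close>

context G_extension_field
begin

lemma intermediate_fieldD: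
  assumes "M \<in> intermediate_fields L K"
  shows "subfield M L" "K \<subseteq> M" "M \<subseteq> carrier L"
  using assms subfieldE(3)[of M L] by (auto simp: intermediate_fields_def)

lemma automorphism_fixes_scalars:
  assumes "h \<in> alg_automorphisms L M" "m \<in> M" "M \<subseteq> carrier L"
  shows "h m = m"
  using pointwise_stabilizer_eq[of M M] assms by (auto simp: pointwise_stabilizer_def)

lemma centralizer_inter_G:
  assumes M: "M \<in> intermediate_fields L K"
  shows "centralizer E (mult_op L ` M) \<inter> G = alg_automorphisms L M"
proof -
  note MD = intermediate_fieldD[OF M]
  have "carrier (endo_ring L M) \<subseteq> carrier E"
    using centralizer_mult_op[OF MD(2,3)] by (auto simp: centralizer_def)
  then show ?thesis
    unfolding centralizer_mult_op[OF MD(2,3)] by (auto simp: alg_automorphisms_def)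
qed

lemma centralizer_is_skew_algebra:
  assumes M: "M \<in> intermediate_fields L K"
  shows "centralizer E (mult_op L ` M) = skew_algebra L K (alg_automorphisms L M)"
  using subalgebra_eq_skew_algebra[OF centralizer_subalgebra_over[OF base_field(2) intermediate_fieldD(3)[OF M]]]
  by (simp only: centralizer_inter_G[OF M])

text \<open>
  An endomorphism \<open>f\<close> that commutes with \<open>L\<close> is multiplication by \<open>f(1)\<close>; if it commutes with \<open>h\<close> as well,
  evaluation at \<open>1\<close> shows that \<open>h\<close> fixes \<open>f(1)\<close>. Conversely, the centralizer of a fixed element is a
  subalgebra containing \<open>L\<close> and \<open>A \<inter> G\<close>, and these generate \<open>A\<close>.
\<close>

lemma centralizer_of_subalgebra:
  assumes A: "A \<in> \<A>"
  shows "centralizer E A = mult_op L ` fixed_field L (A \<inter> G)"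
proof
  note A_E = subalgebras_overD(2)[OF base_field(2) A]
  show "centralizer E A \<subseteq> mult_op L ` fixed_field L (A \<inter> G)"
  proof
    fix f assume f: "f \<in> centralizer E A"
    have comm: "compose (carrier L) f a x = compose (carrier L) a f x" if "a \<in> A" for a x
      using f that by (simp add: centralizer_def)
    have fE: "f \<in> carrier E" using f by (simp add: centralizer_def)
    have f1: "f \<one> \<in> carrier L" using endo_carrierD(2)[OF fE] by simp
    have "f = mult_op L (f \<one>)"
    proof (rule extensionalityI[OF endo_carrierD(1)[OF fE]])
      fix x assume x: "x \<in> carrier L"
      then have "mult_op L x \<in> A" using A by (auto simp: subalgebras_over_def)
      from comm[OF this, of \<one>] have "f x = x \<otimes> f \<one>"
        using x f1 by (simp add: compose_def mult_op_def)
      then show "f x = mult_op L (f \<one>) x" using x f1 by (simp add: mult_op_def m_comm)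
    qed (simp add: mult_op_def)
    moreover have "h (f \<one>) = f \<one>" if h: "h \<in> A \<inter> G" for h
      using comm[of h \<one>] h ring_hom_one[OF alg_automorphismsD(3)[of h L K]]
      by (simp add: compose_def)
    then have "f \<one> \<in> fixed_field L (A \<inter> G)" using f1 by (simp add: fixed_field_def)
    ultimately show "f \<in> mult_op L ` fixed_field L (A \<inter> G)" by (rule image_eqI)
  qed
  show "mult_op L ` fixed_field L (A \<inter> G) \<subseteq> centralizer E A"
  proof (rule image_subsetI)
    fix l assume "l \<in> fixed_field L (A \<inter> G)"
    then have l: "l \<in> carrier L" and fixed: "\<And>h. h \<in> A \<inter> G \<Longrightarrow> h l = l"
      by (auto simp: fixed_field_def)
    let ?B = "centralizer E (mult_op L ` {l})"
    have B: "?B \<in> \<A>" by (rule centralizer_subalgebra_over[OF base_field(2)]) (simp add: l)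
    have "h \<in> ?B" if h: "h \<in> A \<inter> G" for h
    proof -
      have hG: "h \<in> G" using h by simp
      have hE: "h \<in> carrier E" using alg_automorphismsD(1)[OF hG] .
      have "compose (carrier L) h (mult_op L l) = compose (carrier L) (mult_op L l) h"
        unfolding mult_op_compose[OF hE] compose_mult_op[OF l]
        by (rule restrict_ext) (simp add: ring_hom_mult[OF alg_automorphismsD(3)[OF hG] l] fixed[OF h])
      then show ?thesis using hE by (simp add: centralizer_def)
    qed
    then have "A \<inter> G \<subseteq> ?B" by blast
    then have "skew_algebra L K (A \<inter> G) \<subseteq> ?B"
      unfolding skew_algebra_def using B by (intro hull_minimal) (auto simp: subalgebras_over_def)
    then have "A \<subseteq> ?B" using subalgebra_eq_skew_algebra[OF A] by simp
    then have "mult_op L l \<otimes>\<^bsub>E\<^esub> a = a \<otimes>\<^bsub>E\<^esub> mult_op L l" if "a \<in> A" for a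
      using that by (auto simp: centralizer_def)
    then show "mult_op L l \<in> centralizer E A"
      using mult_op_closed[OF base_field(2) l] by (simp add: centralizer_def)
  qed
qed

text \<open>
  By \<open>centralizer_of_subalgebra\<close> a fixed element \<open>l\<close> commutes with all \<open>M\<close>-linear maps. Evaluating at \<open>1\<close>
  the relation with an \<open>M\<close>-linear \<open>\<phi>\<close> that vanishes on \<open>M\<close> gives \<open>\<phi>(l) = l \<phi>(1) = 0\<close>.
\<close>

lemma fixed_field_of_automorphisms:
  assumes M: "M \<in> intermediate_fields L K"
  shows "fixed_field L (alg_automorphisms L M) = M"
proof
  note MD = intermediate_fieldD[OF M]
  let ?C = "centralizer E (mult_op L ` M)"
  have C: "?C \<in> \<A>" by (rule centralizer_subalgebra_over[OF base_field(2) MD(3)])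
  show "M \<subseteq> fixed_field L (alg_automorphisms L M)"
    using automorphism_fixes_scalars[OF _ _ MD(3)] MD(3) by (auto simp: fixed_field_def)
  show "fixed_field L (alg_automorphisms L M) \<subseteq> M"
  proof (rule subsetI, rule ccontr)
    fix l assume l: "l \<in> fixed_field L (alg_automorphisms L M)" and nM: "l \<notin> M"
    have lc: "l \<in> carrier L" using l by (simp add: fixed_field_def)
    have central: "mult_op L l \<in> centralizer E ?C"
      using l unfolding centralizer_of_subalgebra[OF C] centralizer_inter_G[OF M] by (rule imageI)
    note Mr = subfieldE(1)[OF MD(1)]
    have "subalgebra M M L"
      using subring.axioms(1)[OF Mr] subringE(6)[OF Mr] by (simp add: subalgebra_def subalgebra_axioms_def)
    from separating_functional[OF MD(1) this lc nM] obtain \<phi>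
      where \<phi>: "\<phi> \<in> carrier (endo_ring L M)" "\<forall>m\<in>M. \<phi> m = \<zero>" "\<phi> l = \<one>" by blast
    have "\<phi> \<in> ?C" using \<phi>(1) by (simp only: centralizer_mult_op[OF MD(2,3)])
    then have "compose (carrier L) (mult_op L l) \<phi> \<one> = compose (carrier L) \<phi> (mult_op L l) \<one>"
      using central by (simp add: centralizer_def)
    then have "l \<otimes> \<phi> \<one> = \<phi> l"
      using lc endo_carrierD(2)[OF \<phi>(1) one_closed] by (simp add: compose_def mult_op_def)
    moreover have "\<phi> \<one> = \<zero>" using \<phi>(2) subringE(3)[OF Mr] by blast
    ultimately show False using \<phi>(3) lc by simp
  qed
qed

lemma fixed_field_intermediate:
  assumes H: "H \<subseteq> G"
  shows "fixed_field L H \<in> intermediate_fields L K"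
proof -
  have hom: "h \<in> ring_hom L L" if "h \<in> H" for h
    using alg_automorphismsD(3) H that by blast
  have D: "l \<in> carrier L" "h \<in> H \<Longrightarrow> h l = l" if "l \<in> fixed_field L H" for l h
    using that by (simp_all add: fixed_field_def)
  have I: "l \<in> fixed_field L H" if "l \<in> carrier L" "\<And>h. h \<in> H \<Longrightarrow> h l = l" for l
    using that by (simp add: fixed_field_def)
  have cring_hom: "ring_hom_cring L L h" if "h \<in> H" for h
    using hom[OF that] by (intro ring_hom_cring.intro is_cring) (simp add: ring_hom_cring_axioms_def)
  have "subfield (fixed_field L H) L"
  proof (rule subfieldI'[OF subringI])
    show "fixed_field L H \<subseteq> carrier L" using D(1) by blast
    show "\<one> \<in> fixed_field L H" by (rule I) (simp_all add: ring_hom_one[OF hom])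
    show "\<ominus> l \<in> fixed_field L H" if l: "l \<in> fixed_field L H" for l
      by (rule I) (simp_all add: D(1)[OF l] D(2)[OF l] ring_hom_cring.hom_a_inv[OF cring_hom])
    show "l \<otimes> m \<in> fixed_field L H" if l: "l \<in> fixed_field L H" and m: "m \<in> fixed_field L H" for l m
      by (rule I) (simp_all add: D(1)[OF l] D(2)[OF l] D(1)[OF m] D(2)[OF m] ring_hom_mult[OF hom])
    show "l \<oplus> m \<in> fixed_field L H" if l: "l \<in> fixed_field L H" and m: "m \<in> fixed_field L H" for l m
      by (rule I) (simp_all add: D(1)[OF l] D(2)[OF l] D(1)[OF m] D(2)[OF m] ring_hom_add[OF hom])
    show "inv l \<in> fixed_field L H" if l: "l \<in> fixed_field L H - {\<zero>}" for l
    proof (rule I)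
      have lU: "l \<in> Units L" using l D(1) by (auto simp: field_Units)
      have lc: "l \<in> carrier L" "inv l \<in> carrier L" using lU by auto
      show "inv l \<in> carrier L" by (rule lc(2))
      fix h assume h: "h \<in> H"
      have hc: "h (inv l) \<in> carrier L" using ring_hom_closed[OF hom[OF h] lc(2)] .
      have "l \<otimes> h (inv l) = h (l \<otimes> inv l)"
        using ring_hom_mult[OF hom[OF h] lc] D(2)[OF _ h, of l] l by simp
      also have "\<dots> = \<one>"
        using ring_hom_one[OF hom[OF h]] lU by simp
      finally show "h (inv l) = inv l"
        using comm_inv_char[OF lc(1) hc] by simp
    qed
  qed
  moreover have "K \<subseteq> fixed_field L H"
    using automorphism_fixes_scalars[OF _ _ base_field(2)] H base_field(2) by (auto intro!: I)
  ultimately show ?thesis by (simp add: intermediate_fields_def)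
qed

lemma automorphisms_over_fixed_field:
  assumes H: "H \<subseteq> G" and one: "(\<lambda>x\<in>carrier L. x) \<in> H"
    and comp: "\<And>f h. f \<in> H \<Longrightarrow> h \<in> H \<Longrightarrow> compose (carrier L) f h \<in> H"
  shows "alg_automorphisms L (fixed_field L H) = H"
proof -
  let ?M = "fixed_field L H"
  note MD = intermediate_fieldD[OF fixed_field_intermediate[OF H]]
  note stab = pointwise_stabilizer_eq[OF MD(2,3)]
  show ?thesis
  proof
    show "alg_automorphisms L ?M \<subseteq> H"
    proof
      fix g assume "g \<in> alg_automorphisms L ?M"
      then have g: "g \<in> G" and fixed: "\<forall>l\<in>?M. g l = l"
        unfolding stab[symmetric] by (auto simp: pointwise_stabilizer_def)
      show "g \<in> H"
        by (rule stabilizer_of_fixed_field[OF finite_subset[OF H finite_G] H one _ g])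
          (simp_all add: comp fixed)
    qed
    show "H \<subseteq> alg_automorphisms L ?M"
      unfolding stab[symmetric] using H by (auto simp: pointwise_stabilizer_def fixed_field_def)
  qed
qed

text \<open>
  Both sides are generated by \<open>L\<close> and the automorphisms they contain. The latter agree by
  \<open>stabilizer_of_fixed_field\<close>, because \<open>A \<inter> G\<close> is closed under composition.
\<close>

lemma centralizer_of_fixed_field:
  assumes A: "A \<in> \<A>"
  shows "centralizer E (mult_op L ` fixed_field L (A \<inter> G)) = A"
proof -
  note subA = subringE[OF subalgebras_overD(1)[OF base_field(2) A]]
  have "alg_automorphisms L (fixed_field L (A \<inter> G)) = A \<inter> G"
  proof (rule automorphisms_over_fixed_field)
    show "(\<lambda>x\<in>carrier L. x) \<in> A \<inter> G" using subA(3) id_in_G by (simp only: endo_ring_simps IntI)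
    show "compose (carrier L) f h \<in> A \<inter> G" if "f \<in> A \<inter> G" "h \<in> A \<inter> G" for f h
      using subA(6)[of f h] compose_in_G[of f h] that by simp
  qed simp
  then show ?thesis
    using centralizer_is_skew_algebra[OF fixed_field_intermediate, of "A \<inter> G"]
      subalgebra_eq_skew_algebra[OF A] by simp
qed

lemma automorphisms_subgroup:
  assumes M: "M \<in> intermediate_fields L K"
  shows "alg_automorphisms L M \<in> galois_subgroups L K"
proof -
  note MD = intermediate_fieldD[OF M]
  have "alg_automorphisms L M \<subseteq> G"
    using centralizer_inter_G[OF M] by blast
  then show ?thesis
    unfolding galois_subgroups_def galois_group_def mem_Collect_eq
    by (rule group.subgroup_incl[OF group_BijGroup alg_automorphisms_subgroup[OF MD(3)] G_subgroup])
qed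

lemma automorphisms_over_fixed_field_of_subgroup:
  assumes "H \<in> galois_subgroups L K"
  shows "H \<subseteq> G" "alg_automorphisms L (fixed_field L H) = H"
proof -
  have H: "subgroup H (galois_group L K)" using assms by (simp add: galois_subgroups_def)
  show sub: "H \<subseteq> G" using subgroup.subset[OF H] by simp
  show "alg_automorphisms L (fixed_field L H) = H"
  proof (rule automorphisms_over_fixed_field[OF sub])
    show "(\<lambda>x\<in>carrier L. x) \<in> H"
      using subgroup.one_closed[OF H] by (simp add: galois_group_def BijGroup_def)
    show "compose (carrier L) f h \<in> H" if "f \<in> H" "h \<in> H" for f h
    proof -
      have "f \<in> Bij (carrier L)" "h \<in> Bij (carrier L)"
        using that sub subgroup.subset[OF G_subgroup] by (auto simp: BijGroup_def)
      then show ?thesis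
        using subgroup.m_closed[OF H that] by (simp add: galois_group_def BijGroup_def)
    qed
  qed
qed

end

theorem theorem3p6:
  fixes L :: "('a, 'b) ring_scheme" and K :: "'a set"
  defines "E \<equiv> endo_ring L K"
    and "G \<equiv> carrier (galois_group L K)"
    and "\<F> \<equiv> intermediate_fields L K"
    and "\<A> \<equiv> subalgebras_over L K"
    and "\<G> \<equiv> galois_subgroups L K"
  assumes "G_extension L K"
  shows
    "((\<forall>M\<in>\<F>. centralizer E (mult_op L ` M) = skew_algebra L K (carrier (galois_group L M)) \<and>
              skew_algebra L K (carrier (galois_group L M)) =
                skew_algebra L K (pointwise_stabilizer L K M)) \<and>
      \<A> = {centralizer E (mult_op L ` M) | M. M \<in> \<F>}) \<and>
     (bij_betw (\<lambda>M. centralizer E (mult_op L ` M)) \<F> \<A> \<and>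
      (\<forall>A\<in>\<A>. centralizer E A = mult_op L ` fixed_field L (A \<inter> G)) \<and>
      (\<forall>M\<in>\<F>. fixed_field L (centralizer E (mult_op L ` M) \<inter> G) = M) \<and>
      (\<forall>A\<in>\<A>. fixed_field L (A \<inter> G) \<in> \<F> \<and>
              centralizer E (mult_op L ` fixed_field L (A \<inter> G)) = A)) \<and>
     ((\<forall>M\<in>\<F>. carrier (galois_group L M) = pointwise_stabilizer L K M) \<and>
      bij_betw (\<lambda>M. carrier (galois_group L M)) \<F> \<G> \<and>
      (\<forall>M\<in>\<F>. fixed_field L (carrier (galois_group L M)) = M) \<and>
      (\<forall>H\<in>\<G>. fixed_field L H \<in> \<F> \<and> carrier (galois_group L (fixed_field L H)) = H))"
proof -
  interpret field L using \<open>G_extension L K\<close> by (simp add: G_extension_def)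
  interpret X: G_extension_field L K by unfold_locales (rule \<open>G_extension L K\<close>)
  have stab: "alg_automorphisms L M = pointwise_stabilizer L K M" if "M \<in> \<F>" for M
    using pointwise_stabilizer_eq X.intermediate_fieldD(2,3)[OF that[unfolded \<F>_def]] by simp
  have C: "centralizer E (mult_op L ` M) \<in> \<A>" if "M \<in> \<F>" for M
    using centralizer_subalgebra_over[OF X.base_field(2)] X.intermediate_fieldD(3) that
    by (simp add: E_def \<A>_def \<F>_def)
  have CG: "fixed_field L (centralizer E (mult_op L ` M) \<inter> G) = M" if "M \<in> \<F>" for M
    using X.centralizer_inter_G X.fixed_field_of_automorphisms that
    by (simp add: E_def G_def \<F>_def)
  have F: "fixed_field L (A \<inter> G) \<in> \<F>" for A
    using X.fixed_field_intermediate[of "A \<inter> G"] by (simp add: G_def \<F>_def)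
  have CF: "centralizer E (mult_op L ` fixed_field L (A \<inter> G)) = A" if "A \<in> \<A>" for A
    using X.centralizer_of_fixed_field that by (simp add: E_def G_def \<A>_def)
  have FM: "fixed_field L (alg_automorphisms L M) = M" if "M \<in> \<F>" for M
    using X.fixed_field_of_automorphisms that by (simp add: \<F>_def)
  have H: "fixed_field L H \<in> \<F>" "alg_automorphisms L (fixed_field L H) = H" if "H \<in> \<G>" for H
    using X.fixed_field_intermediate X.automorphisms_over_fixed_field_of_subgroup that
    by (simp_all add: \<F>_def \<G>_def)
  have skew: "centralizer E (mult_op L ` M) = skew_algebra L K (alg_automorphisms L M)"
    and skew_stab: "skew_algebra L K (alg_automorphisms L M) = skew_algebra L K (pointwise_stabilizer L K M)"
    if "M \<in> \<F>" for M
    using X.centralizer_is_skew_algebra that stab[OF that] by (simp_all add: E_def \<F>_def)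
  have all: "\<A> = {centralizer E (mult_op L ` M) | M. M \<in> \<F>}"
    using C CF F by blast
  have bij_A: "bij_betw (\<lambda>M. centralizer E (mult_op L ` M)) \<F> \<A>"
    by (rule bij_betw_byWitness[where f' = "\<lambda>A. fixed_field L (A \<inter> G)"])
      (use C CG CF F in auto)
  have inverse: "centralizer E A = mult_op L ` fixed_field L (A \<inter> G)" if "A \<in> \<A>" for A
    using X.centralizer_of_subalgebra that by (simp add: E_def G_def \<A>_def)
  have bij_G: "bij_betw (\<lambda>M. alg_automorphisms L M) \<F> \<G>"
    by (rule bij_betw_byWitness[where f' = "fixed_field L"])
      (use FM H X.automorphisms_subgroup in \<open>auto simp: \<F>_def \<G>_def\<close>)
  show ?thesis
    unfolding carrier_galois_group
    by (intro conjI ballI)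
      (assumption | rule skew skew_stab all bij_A inverse CG F CF stab bij_G FM H)+
qed

end
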